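(* Let $$\lambda_8=\frac{1}{\sqrt2}\begin{pmatrix}1&0&0\\0&1&0\\0&0&-2\end{pmatrix}.$$ Then the adjacency matrix $A:=\lambda_8\otimes\lambda_8$, i.e. the operator $A(x)=\lambda_8\,x\,\lambda_8$ on $l^2(M_3)=M_3(\mathbb{C})$, defines a simple quantum graph on the quantum space $M_3$ which is not quantum isomorphic to any classical graph.
   Context: **Finite quantum sets and quantum graphs.** A finite quantum set $X$ is a finite-dimensional C*-algebra $C(X)\cong\bigoplus_i M_{n_i}(\mathbb{C})$ with the functional (counit) $\eta^\dag(x)=\sum_i n_i\mathrm{Tr}(x_i)$; $M_n$ is the one with $C(M_n)=M_n(\mathbb{C})$. $l^2(X)$ is $C(X)$ with inner product $\langle a,b\rangle=\eta^\dag(a^*b)$; $m$ is the multiplication, $\eta$ the unit map, $\dag$ denotes Hilbert space adjoints; $mm^\dag=\mathrm{id}$. Put $R^\dag=\eta^\dag m$, $R=m^\dag\eta$. A quantum graph on $X$ is an orthogonal projection $\tilde A\in C(X)\otimes C(X)^{\rm op}$, or equivalently its adjacency matrix $A=(\mathrm{id}\otimes R^\dag)(\tilde A\otimes\mathrm{id})\colon l^2(X)\to l^2(X)$; conversely $\tilde A=(A\otimes\mathrm{id})R$. It is simple if $\tilde A$ is invariant under the swap (undirected) and $\tilde A\tilde I=0$ (no loops), where $\tilde I$ is $R$ viewed in $C(X)\otimes C(X)^{\rm op}$. It is classical if $C(X)$ is commutative, i.e. the algebra of functions on a finite set. **Quantum isomorphism.** For an orthonormal basis $(e_i)_{i=1}^N$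 of $l^2(X)$ and $F$ with $e_i^*=\sum_jF_i^je_j$, $\mathrm{Aut}^+X$ is the compact matrix quantum group whose $*$-algebra is the universal unital $*$-algebra generated by $u^i_j$ with relations: $u$ unitary, $uF=F\bar u$, $m(u\otimes u)=um$, $Au=uA$ ($[\bar u]^i_j=u^{i*}_j$), and $\Delta(u^i_j)=\sum_ku^i_k\otimes u^k_j$. For $G=\mathrm{Aut}^+X$ let $\mathfrak{C}_G(k,l)=\{T\mid Tu^{\otimes k}=u^{\otimes l}T\}$, a monoidal $\dag$-category with objects $\mathbb{N}_0$. Quantum graphs $X_1,X_2$ with $G_i=\mathrm{Aut}^+X_i$ are quantum isomorphic if there is a monoidal $\dag$-category isomorphism $\mathfrak{C}_{G_1}\to\mathfrak{C}_{G_2}$ (identity on objects; equivalently a monoidal equivalence $\mathrm{Rep}\,G_1\to\mathrm{Rep}\,G_2$ with $u_1\mapsto u_2$) mapping $A_1\mapsto A_2$ (and, as understood, $m_1\mapsto m_2$, $\eta_1\mapsto\eta_2$). *)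

theory Defs
  imports "Jordan_Normal_Form.Schur_Decomposition" "HOL-Library.Poly_Mapping"
begin

section \<open>Finite quantum sets\<close>

text \<open>
  A finite quantum set \<open>X\<close> is given by the list of block sizes \<open>n\<^sub>0, n\<^sub>1, \<dots>\<close> of the
  finite-dimensional C*-algebra \<open>C(X) = M\<^bsub>n\<^sub>0\<^esub>(\<complex>) \<oplus> M\<^bsub>n\<^sub>1\<^esub>(\<complex>) \<oplus> \<dots>\<close>, whose elements are the lists
  of their blocks. Every finite-dimensional C*-algebra is *-isomorphic to one of this
  form, and the counit does not depend on the isomorphism.
\<close>

type_synonym qset = "nat list"
type_synonym qelem = "complex mat list"

definition finite_quantum_set :: "qset \<Rightarrow> bool" where
  "finite_quantum_set X \<longleftrightarrow> (\<forall>n\<in>set X. n > 0)"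

definition quantum_M :: "nat \<Rightarrow> qset" where
  "quantum_M n = [n]"

definition q_carrier :: "qset \<Rightarrow> qelem set" where
  "q_carrier X =
     {x. length x = length X \<and> (\<forall>b<length X. x ! b \<in> carrier_mat (X ! b) (X ! b))}"

definition q_add :: "qelem \<Rightarrow> qelem \<Rightarrow> qelem" where
  "q_add x y = map2 (+) x y"

definition q_smult :: "complex \<Rightarrow> qelem \<Rightarrow> qelem" where
  "q_smult c x = map (\<lambda>a. c \<cdot>\<^sub>m a) x"

definition q_mult :: "qelem \<Rightarrow> qelem \<Rightarrow> qelem" where
  "q_mult x y = map2 (*) x y"

definition q_star :: "qelem \<Rightarrow> qelem" where
  "q_star x = map mat_adjoint x"

definition q_one :: "qset \<Rightarrow> qelem" where
  "q_one X = map 1\<^sub>m X"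

definition q_counit :: "qset \<Rightarrow> qelem \<Rightarrow> complex" where
  "q_counit X x = (\<Sum>b<length X. of_nat (X ! b) * (\<Sum>i<X ! b. (x ! b) $$ (i, i)))"

definition q_inner :: "qset \<Rightarrow> qelem \<Rightarrow> qelem \<Rightarrow> complex" where
  "q_inner X x y = q_counit X (q_mult (q_star x) y)"

definition q_linear :: "qset \<Rightarrow> (qelem \<Rightarrow> qelem) \<Rightarrow> bool" where
  "q_linear X A \<longleftrightarrow>
     (\<forall>x\<in>q_carrier X. A x \<in> q_carrier X) \<and>
     (\<forall>x\<in>q_carrier X. \<forall>y\<in>q_carrier X. A (q_add x y) = q_add (A x) (A y)) \<and>
     (\<forall>c. \<forall>x\<in>q_carrier X. A (q_smult c x) = q_smult c (A x))"

definition q_commutative :: "qset \<Rightarrow> bool" where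
  "q_commutative X \<longleftrightarrow> (\<forall>x\<in>q_carrier X. \<forall>y\<in>q_carrier X. q_mult x y = q_mult y x)"

text \<open>
  The orthonormal basis of \<open>l\<^sup>2(X)\<close> used throughout consists of the normalised matrix units
  \<open>e\<^bsub>(b,i,j)\<^esub> = E\<^sub>i\<^sub>j / \<surd>n\<^sub>b\<close> of the blocks; the factor is forced by \<open>\<langle>E\<^sub>i\<^sub>j, E\<^sub>i\<^sub>j\<rangle> = n\<^sub>b\<close>.
  Another orthonormal basis only conjugates all the matrices below by a unitary.
\<close>

type_synonym idx = "nat \<times> nat \<times> nat"

definition q_idx :: "qset \<Rightarrow> idx set" where
  "q_idx X = {(b, i, j). b < length X \<and> i < X ! b \<and> j < X ! b}"

fun q_basis :: "qset \<Rightarrow> idx \<Rightarrow> qelem" where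
  "q_basis X (b, i, j) =
     map (\<lambda>c. mat (X ! c) (X ! c)
               (\<lambda>(k, l). if c = b \<and> k = i \<and> l = j then 1 / complex_of_real (sqrt (real (X ! c))) else 0))
         [0..<length X]"

definition q_coord :: "qset \<Rightarrow> idx \<Rightarrow> qelem \<Rightarrow> complex" where
  "q_coord X p x = q_inner X (q_basis X p) x"


section \<open>Operators between tensor powers of the Hilbert space\<close>

text \<open>
  The space \<open>l\<^sup>2(X)\<^sup>\<otimes>\<^sup>k\<close> has the orthonormal basis \<open>e\<^bsub>p\<^sub>1\<^esub> \<otimes> \<dots> \<otimes> e\<^bsub>p\<^sub>k\<^esub>\<close>, indexed by the lists of length
  \<open>k\<close> over \<open>q_idx X\<close>. A linear map \<open>T : l\<^sup>2(X)\<^sup>\<otimes>\<^sup>k \<rightarrow> l\<^sup>2(X)\<^sup>\<otimes>\<^sup>l\<close> is represented by its matrix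
  entries \<open>T ys xs\<close> (row \<open>ys\<close>, column \<open>xs\<close>), which vanish outside the index range.
\<close>

type_synonym op_matrix = "idx list \<Rightarrow> idx list \<Rightarrow> complex"

definition multi_idx :: "qset \<Rightarrow> nat \<Rightarrow> idx list set" where
  "multi_idx X k = {xs. length xs = k \<and> set xs \<subseteq> q_idx X}"

definition ops :: "qset \<Rightarrow> nat \<Rightarrow> nat \<Rightarrow> op_matrix set" where
  "ops X k l = {T. \<forall>ys xs. \<not> (ys \<in> multi_idx X l \<and> xs \<in> multi_idx X k) \<longrightarrow> T ys xs = 0}"

definition mk_op :: "qset \<Rightarrow> nat \<Rightarrow> nat \<Rightarrow> op_matrix \<Rightarrow> op_matrix" where
  "mk_op X k l f =
     (\<lambda>ys xs. if ys \<in> multi_idx X l \<and> xs \<in> multi_idx X k then f ys xs else 0)"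

definition op_add :: "op_matrix \<Rightarrow> op_matrix \<Rightarrow> op_matrix" where
  "op_add S T = (\<lambda>ys xs. S ys xs + T ys xs)"

definition op_smult :: "complex \<Rightarrow> op_matrix \<Rightarrow> op_matrix" where
  "op_smult c T = (\<lambda>ys xs. c * T ys xs)"

definition op_id :: "qset \<Rightarrow> nat \<Rightarrow> op_matrix" where
  "op_id X k = mk_op X k k (\<lambda>ys xs. if ys = xs then 1 else 0)"

text \<open>In \<open>op_comp X l S T\<close>, the number \<open>l\<close> is the tensor degree of the codomain of \<open>T\<close>.\<close>

definition op_comp :: "qset \<Rightarrow> nat \<Rightarrow> op_matrix \<Rightarrow> op_matrix \<Rightarrow> op_matrix" where
  "op_comp X l S T = (\<lambda>zs xs. \<Sum>ys\<in>multi_idx X l. S zs ys * T ys xs)"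

text \<open>\<open>op_tensor k l S T\<close> is \<open>S \<otimes> T\<close> for \<open>S : l\<^sup>2(X)\<^sup>\<otimes>\<^sup>k \<rightarrow> l\<^sup>2(X)\<^sup>\<otimes>\<^sup>l\<close>.\<close>

definition op_tensor :: "nat \<Rightarrow> nat \<Rightarrow> op_matrix \<Rightarrow> op_matrix \<Rightarrow> op_matrix" where
  "op_tensor k l S T =
     (\<lambda>ys xs. S (take l ys) (take k xs) * T (drop l ys) (drop k xs))"

definition op_dagger :: "op_matrix \<Rightarrow> op_matrix" where
  "op_dagger T = (\<lambda>xs ys. cnj (T ys xs))"

definition mult_op :: "qset \<Rightarrow> op_matrix" where
  "mult_op X =
     mk_op X 2 1 (\<lambda>ys xs. q_coord X (ys ! 0) (q_mult (q_basis X (xs ! 0)) (q_basis X (xs ! 1))))"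

definition unit_op :: "qset \<Rightarrow> op_matrix" where
  "unit_op X = mk_op X 0 1 (\<lambda>ys xs. q_coord X (ys ! 0) (q_one X))"

definition lin_op :: "qset \<Rightarrow> (qelem \<Rightarrow> qelem) \<Rightarrow> op_matrix" where
  "lin_op X A = mk_op X 1 1 (\<lambda>ys xs. q_coord X (ys ! 0) (A (q_basis X (xs ! 0))))"

definition R_op :: "qset \<Rightarrow> op_matrix" where
  "R_op X = op_comp X 1 (op_dagger (mult_op X)) (unit_op X)"


section \<open>Quantum graphs\<close>

text \<open>
  An element \<open>\<Sum> t\<^sub>p\<^sub>q e\<^sub>p \<otimes> e\<^sub>q\<close> of \<open>C(X) \<otimes> C(X)\<^sup>o\<^sup>p\<close> is a vector of \<open>l\<^sup>2(X) \<otimes> l\<^sup>2(X)\<close>, i.e. the member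
  \<open>T\<close> of \<open>ops X 0 2\<close> with \<open>T [p, q] [] = t\<^sub>p\<^sub>q\<close>. The product and the involution are determined
  by \<open>(e\<^sub>p \<otimes> e\<^sub>q)(e\<^sub>r \<otimes> e\<^sub>s) = e\<^sub>p e\<^sub>r \<otimes> e\<^sub>s e\<^sub>q\<close> and \<open>(e\<^sub>p \<otimes> e\<^sub>q)\<^sup>* = e\<^sub>p\<^sup>* \<otimes> e\<^sub>q\<^sup>*\<close>.
\<close>

definition env_mult :: "qset \<Rightarrow> op_matrix \<Rightarrow> op_matrix \<Rightarrow> op_matrix" where
  "env_mult X S T = mk_op X 0 2 (\<lambda>ys xs.
     \<Sum>p\<in>q_idx X. \<Sum>q\<in>q_idx X. \<Sum>r\<in>q_idx X. \<Sum>s\<in>q_idx X.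
       S [p, q] [] * T [r, s] []
       * q_coord X (ys ! 0) (q_mult (q_basis X p) (q_basis X r))
       * q_coord X (ys ! 1) (q_mult (q_basis X s) (q_basis X q)))"

definition env_star :: "qset \<Rightarrow> op_matrix \<Rightarrow> op_matrix" where
  "env_star X T = mk_op X 0 2 (\<lambda>ys xs.
     \<Sum>p\<in>q_idx X. \<Sum>q\<in>q_idx X.
       cnj (T [p, q] [])
       * q_coord X (ys ! 0) (q_star (q_basis X p))
       * q_coord X (ys ! 1) (q_star (q_basis X q)))"

definition env_swap :: "qset \<Rightarrow> op_matrix \<Rightarrow> op_matrix" where
  "env_swap X T = mk_op X 0 2 (\<lambda>ys xs. T (rev ys) xs)"

definition edge_projection :: "qset \<Rightarrow> (qelem \<Rightarrow> qelem) \<Rightarrow> op_matrix" where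
  "edge_projection X A = op_comp X 2 (op_tensor 1 1 (lin_op X A) (op_id X 1)) (R_op X)"

definition quantum_graph :: "qset \<Rightarrow> (qelem \<Rightarrow> qelem) \<Rightarrow> bool" where
  "quantum_graph X A \<longleftrightarrow>
     finite_quantum_set X \<and> q_linear X A \<and>
     env_mult X (edge_projection X A) (edge_projection X A) = edge_projection X A \<and>
     env_star X (edge_projection X A) = edge_projection X A"

definition simple_quantum_graph :: "qset \<Rightarrow> (qelem \<Rightarrow> qelem) \<Rightarrow> bool" where
  "simple_quantum_graph X A \<longleftrightarrow>
     quantum_graph X A \<and>
     env_swap X (edge_projection X A) = edge_projection X A \<and>
     env_mult X (edge_projection X A) (R_op X) = (\<lambda>ys xs. 0)"

definition classical_graph :: "qset \<Rightarrow> (qelem \<Rightarrow> qelem) \<Rightarrow> bool" where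
  "classical_graph X A \<longleftrightarrow> quantum_graph X A \<and> q_commutative X"


section \<open>Free unital *-algebras\<close>

text \<open>
  \<open>Gen i j\<close> stands for the generator \<open>u\<^sup>i\<^sub>j\<close> and \<open>GenStar i j\<close> for its adjoint. With words under
  concatenation as exponents, the polynomials \<open>gen word \<Rightarrow>\<^sub>0 complex\<close> are noncommutative.
\<close>

datatype gen = Gen idx idx | GenStar idx idx

datatype 'a word = Word (letters: "'a list")

instantiation word :: (type) monoid_add
begin

definition "0 = Word []"
definition "v + w = Word (letters v @ letters w)"

instance by standard (simp_all add: zero_word_def plus_word_def)

end

type_synonym free_star_alg = "gen word \<Rightarrow>\<^sub>0 complex"

fun gen_star :: "gen \<Rightarrow> gen" where
  "gen_star (Gen i j) = GenStar i j"
| "gen_star (GenStar i j) = Gen i j"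

definition word_star :: "gen word \<Rightarrow> gen word" where
  "word_star w = Word (rev (map gen_star (letters w)))"

text \<open>
  \<open>map_key f\<close> is composition with \<open>f\<close> provided that \<open>f\<close> is injective, which holds for the
  involution \<open>word_star\<close>.
\<close>

definition alg_star :: "free_star_alg \<Rightarrow> free_star_alg" where
  "alg_star a = Poly_Mapping.map_key word_star (Poly_Mapping.map cnj a)"

lemma word_star_involutive: "word_star (word_star w) = w"
proof -
  have "map (gen_star \<circ> gen_star) xs = xs" for xs
    by (rule map_idI) (metis comp_apply gen.exhaust gen_star.simps)
  then show ?thesis by (simp add: word_star_def rev_map)
qed

lemma lookup_alg_star:
  "Poly_Mapping.lookup (alg_star a) w = cnj (Poly_Mapping.lookup a (word_star w))"
proof -
  have "inj word_star" by (metis injI word_star_involutive)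
  then show ?thesis
    by (simp add: alg_star_def map_key.rep_eq map.rep_eq when_def)
qed

definition alg_const :: "complex \<Rightarrow> free_star_alg" where
  "alg_const c = Poly_Mapping.single 0 c"

definition alg_u :: "idx \<Rightarrow> idx \<Rightarrow> free_star_alg" where
  "alg_u i j = Poly_Mapping.single (Word [Gen i j]) 1"

definition gens :: "qset \<Rightarrow> gen set" where
  "gens X = (\<Union>i\<in>q_idx X. \<Union>j\<in>q_idx X. {Gen i j, GenStar i j})"

definition free_carrier :: "qset \<Rightarrow> free_star_alg set" where
  "free_carrier X = {a. \<forall>w\<in>Poly_Mapping.keys a. set (letters w) \<subseteq> gens X}"

text \<open>The two-sided *-ideal of the free unital *-algebra that is generated by a set of relators.\<close>

inductive_set star_ideal :: "qset \<Rightarrow> free_star_alg set \<Rightarrow> free_star_alg set"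
  for X :: qset and S :: "free_star_alg set" where
  relator: "a \<in> S \<Longrightarrow> a \<in> star_ideal X S"
| zero: "0 \<in> star_ideal X S"
| add: "a \<in> star_ideal X S \<Longrightarrow> b \<in> star_ideal X S \<Longrightarrow> a + b \<in> star_ideal X S"
| left_mult: "a \<in> star_ideal X S \<Longrightarrow> c \<in> free_carrier X \<Longrightarrow> c * a \<in> star_ideal X S"
| right_mult: "a \<in> star_ideal X S \<Longrightarrow> c \<in> free_carrier X \<Longrightarrow> a * c \<in> star_ideal X S"
| star: "a \<in> star_ideal X S \<Longrightarrow> alg_star a \<in> star_ideal X S"


section \<open>The quantum automorphism group\<close>

definition u_tensor :: "idx list \<Rightarrow> idx list \<Rightarrow> free_star_alg" where
  "u_tensor ys xs = prod_list (map2 alg_u ys xs)"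

text \<open>The matrix entries of \<open>T u\<^sup>\<otimes>\<^sup>k - u\<^sup>\<otimes>\<^sup>l T\<close> for \<open>T : l\<^sup>2(X)\<^sup>\<otimes>\<^sup>k \<rightarrow> l\<^sup>2(X)\<^sup>\<otimes>\<^sup>l\<close>.\<close>

definition intertwiner_defect ::
    "qset \<Rightarrow> nat \<Rightarrow> nat \<Rightarrow> op_matrix \<Rightarrow> idx list \<Rightarrow> idx list \<Rightarrow> free_star_alg" where
  "intertwiner_defect X k l T ys xs =
     (\<Sum>zs\<in>multi_idx X k. alg_const (T ys zs) * u_tensor zs xs)
     - (\<Sum>zs\<in>multi_idx X l. u_tensor ys zs * alg_const (T zs xs))"

definition defects :: "qset \<Rightarrow> nat \<Rightarrow> nat \<Rightarrow> op_matrix \<Rightarrow> free_star_alg set" where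
  "defects X k l T =
     {intertwiner_defect X k l T ys xs | ys xs. ys \<in> multi_idx X l \<and> xs \<in> multi_idx X k}"

definition unitarity_relators :: "qset \<Rightarrow> free_star_alg set" where
  "unitarity_relators X =
     {(\<Sum>k\<in>q_idx X. alg_u i k * alg_star (alg_u j k)) - (if i = j then 1 else 0)
        | i j. i \<in> q_idx X \<and> j \<in> q_idx X} \<union>
     {(\<Sum>k\<in>q_idx X. alg_star (alg_u k i) * alg_u k j) - (if i = j then 1 else 0)
        | i j. i \<in> q_idx X \<and> j \<in> q_idx X}"

text \<open>\<open>F_entry X k j\<close> is the coefficient of \<open>e\<^sub>k\<close> in \<open>e\<^sub>j\<^sup>*\<close>.\<close>

definition F_entry :: "qset \<Rightarrow> idx \<Rightarrow> idx \<Rightarrow> complex" where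
  "F_entry X k j = q_coord X k (q_star (q_basis X j))"

definition conjugation_relators :: "qset \<Rightarrow> free_star_alg set" where
  "conjugation_relators X =
     {(\<Sum>k\<in>q_idx X. alg_u i k * alg_const (F_entry X k j))
        - (\<Sum>k\<in>q_idx X. alg_const (F_entry X i k) * alg_star (alg_u k j))
        | i j. i \<in> q_idx X \<and> j \<in> q_idx X}"

text \<open>
  The *-algebra of \<open>Aut\<^sup>+ X\<close> is the quotient of the free unital *-algebra by \<open>aut_ideal X A\<close>.
  The comultiplication does not enter the definition of the intertwiner spaces.
\<close>

definition aut_ideal :: "qset \<Rightarrow> (qelem \<Rightarrow> qelem) \<Rightarrow> free_star_alg set" where
  "aut_ideal X A =
     star_ideal X (unitarity_relators X \<union> conjugation_relators X
                   \<union> defects X 2 1 (mult_op X) \<union> defects X 1 1 (lin_op X A))"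

definition intertwiners ::
    "qset \<Rightarrow> (qelem \<Rightarrow> qelem) \<Rightarrow> nat \<Rightarrow> nat \<Rightarrow> op_matrix set" where
  "intertwiners X A k l = {T \<in> ops X k l. defects X k l T \<subseteq> aut_ideal X A}"


section \<open>Quantum isomorphism\<close>

text \<open>
  A monoidal dagger-category isomorphism that is the identity on objects; as usual for
  functors between categories of representations, it is linear on the morphism spaces.
\<close>

definition monoidal_dagger_iso ::
    "qset \<Rightarrow> (qelem \<Rightarrow> qelem) \<Rightarrow> qset \<Rightarrow> (qelem \<Rightarrow> qelem)
     \<Rightarrow> (nat \<Rightarrow> nat \<Rightarrow> op_matrix \<Rightarrow> op_matrix) \<Rightarrow> bool" where
  "monoidal_dagger_iso X1 A1 X2 A2 \<Phi> \<longleftrightarrow>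
     (\<forall>k l. bij_betw (\<Phi> k l) (intertwiners X1 A1 k l) (intertwiners X2 A2 k l)) \<and>
     (\<forall>k l. \<forall>S\<in>intertwiners X1 A1 k l. \<forall>T\<in>intertwiners X1 A1 k l.
        \<Phi> k l (op_add S T) = op_add (\<Phi> k l S) (\<Phi> k l T)) \<and>
     (\<forall>k l c. \<forall>T\<in>intertwiners X1 A1 k l. \<Phi> k l (op_smult c T) = op_smult c (\<Phi> k l T)) \<and>
     (\<forall>k. \<Phi> k k (op_id X1 k) = op_id X2 k) \<and>
     (\<forall>j k l. \<forall>S\<in>intertwiners X1 A1 k l. \<forall>T\<in>intertwiners X1 A1 j k.
        \<Phi> j l (op_comp X1 k S T) = op_comp X2 k (\<Phi> k l S) (\<Phi> j k T)) \<and>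
     (\<forall>k l k' l'. \<forall>S\<in>intertwiners X1 A1 k l. \<forall>T\<in>intertwiners X1 A1 k' l'.
        \<Phi> (k + k') (l + l') (op_tensor k l S T) = op_tensor k l (\<Phi> k l S) (\<Phi> k' l' T)) \<and>
     (\<forall>k l. \<forall>T\<in>intertwiners X1 A1 k l. \<Phi> l k (op_dagger T) = op_dagger (\<Phi> k l T))"

definition quantum_isomorphic ::
    "qset \<Rightarrow> (qelem \<Rightarrow> qelem) \<Rightarrow> qset \<Rightarrow> (qelem \<Rightarrow> qelem) \<Rightarrow> bool" where
  "quantum_isomorphic X1 A1 X2 A2 \<longleftrightarrow>
     (\<exists>\<Phi>. monoidal_dagger_iso X1 A1 X2 A2 \<Phi> \<and>
          \<Phi> 1 1 (lin_op X1 A1) = lin_op X2 A2 \<and>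
          \<Phi> 2 1 (mult_op X1) = mult_op X2 \<and>
          \<Phi> 0 1 (unit_op X1) = unit_op X2)"


section \<open>The matrix \<open>\<lambda>\<^sub>8\<close>\<close>

definition lambda8 :: "complex mat" where
  "lambda8 = (1 / complex_of_real (sqrt 2)) \<cdot>\<^sub>m
     mat_of_rows_list 3 [[1, 0, 0], [0, 1, 0], [0, 0, -2]]"

end

theory Submission
  imports Defs
begin

text \<open>
  The invariant that separates the graph from all classical ones is the Schur product
  \<open>S \<bullet> T = m (S \<otimes> T) m\<^sup>\<dagger>\<close> of operators on \<open>l\<^sup>2(X)\<close>. If \<open>C(X)\<close> is commutative, then \<open>\<bullet>\<close> is commutative
  (\<open>schur_product_commute\<close>). For two-sided multiplications on \<open>M\<^sub>n\<close>, however, the Schur product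
  of \<open>x \<mapsto> a x b\<close> and \<open>x \<mapsto> a' x b'\<close> is \<open>x \<mapsto> (Tr (b a') / n) a x b'\<close>. With \<open>A(x) = \<lambda>\<^sub>8 x \<lambda>\<^sub>8\<close> this makes
  \<open>A \<bullet> A\<^sup>2\<close> and \<open>A\<^sup>2 \<bullet> A\<close> equal to \<open>Tr \<lambda>\<^sub>8\<^sup>3 / 3\<close> times \<open>x \<mapsto> \<lambda>\<^sub>8 x \<lambda>\<^sub>8\<^sup>2\<close> and \<open>x \<mapsto> \<lambda>\<^sub>8\<^sup>2 x \<lambda>\<^sub>8\<close> respectively.
  These differ, because \<open>Tr \<lambda>\<^sub>8\<^sup>3 \<noteq> 0\<close> and \<open>\<lambda>\<^sub>8\<close> has two distinct nonzero eigenvalues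
  (\<open>not_classical_diag_conj\<close>).

  A quantum isomorphism maps \<open>m\<close> to \<open>m\<close> and preserves composition, tensor product and adjoint of
  intertwiners, hence also Schur products of intertwiners; and it is injective. An isomorphism to a
  classical graph would therefore force \<open>A \<bullet> A\<^sup>2 = A\<^sup>2 \<bullet> A\<close> (\<open>classical_schur_commute\<close>). For this
  argument \<open>m\<^sup>\<dagger>\<close> and the operators built from it must be intertwiners, that is, the relations
  imposed on the free *-algebra must imply theirs. Closure under adjoints is the step that uses
  the unitarity of \<open>u\<close> (\<open>intertwiners_dagger\<close>).

  That \<open>A\<close> is a simple quantum graph comes down to \<open>Tr \<lambda>\<^sub>8\<^sup>2 = 3\<close>, \<open>Tr \<lambda>\<^sub>8 = 0\<close> and \<open>\<lambda>\<^sub>8\<close> being real and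
  diagonal (\<open>simple_quantum_graph_diag_conj\<close>).
\<close>


section \<open>The involution of the free algebra\<close>

lemma free_alg_induct [case_names zero add]:
  fixes a :: free_star_alg
  assumes "P 0" and "\<And>a w c. P a \<Longrightarrow> P (a + Poly_Mapping.single w c)"
  shows "P a"
proof (induction a rule: update_induct)
  case const
  show ?case using assms(1) by simp
next
  case (update f w c)
  have "Poly_Mapping.update w c f = f + Poly_Mapping.single w c"
    using update(1)
    by (intro poly_mapping_eqI) (auto simp: lookup_update lookup_add lookup_single in_keys_iff when_def)
  then show ?case using assms(2) update(3) by simp
qed

lemma alg_star_0 [simp]: "alg_star 0 = 0"
  by (rule poly_mapping_eqI) (simp add: lookup_alg_star)

lemma alg_star_add: "alg_star (a + b) = alg_star a + alg_star b"
  by (rule poly_mapping_eqI) (simp add: lookup_alg_star lookup_add)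

lemma alg_star_diff: "alg_star (a - b) = alg_star a - alg_star b"
  by (rule poly_mapping_eqI) (simp add: lookup_alg_star lookup_minus)

lemma alg_star_sum: "alg_star (sum f I) = (\<Sum>i\<in>I. alg_star (f i))"
  by (induction I rule: infinite_finite_induct) (simp_all add: alg_star_add)

lemma alg_star_single:
  "alg_star (Poly_Mapping.single w c) = Poly_Mapping.single (word_star w) (cnj c)"
  by (rule poly_mapping_eqI)
     (auto simp: lookup_alg_star lookup_single when_def word_star_involutive)

lemma alg_star_star [simp]: "alg_star (alg_star a) = a"
  by (rule poly_mapping_eqI) (simp add: lookup_alg_star word_star_involutive)

lemma word_star_add: "word_star (v + w) = word_star w + word_star v"
  by (simp add: word_star_def plus_word_def)

lemma word_star_0 [simp]: "word_star 0 = 0"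
  by (simp add: word_star_def zero_word_def)

lemma alg_star_mult: "alg_star (a * b) = alg_star b * alg_star a"
proof (induction a rule: free_alg_induct)
  case (add a v c)
  have "alg_star (Poly_Mapping.single v c * b) = alg_star b * alg_star (Poly_Mapping.single v c)"
    by (induction b rule: free_alg_induct)
       (simp_all add: algebra_simps alg_star_add mult_single alg_star_single word_star_add)
  with add show ?case by (simp add: algebra_simps alg_star_add)
qed simp

lemma alg_star_const: "alg_star (alg_const c) = alg_const (cnj c)"
  by (simp add: alg_const_def alg_star_single)

lemma alg_const_1 [simp]: "alg_const 1 = 1"
  by (simp add: alg_const_def)

lemma alg_star_1 [simp]: "alg_star 1 = 1"
  using alg_star_const[of 1] by simp

lemma alg_const_mult: "alg_const (c * d) = alg_const c * alg_const d"
  by (simp add: alg_const_def mult_single)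

lemma alg_const_sum: "alg_const (sum f I) = (\<Sum>i\<in>I. alg_const (f i))"
  by (induction I rule: infinite_finite_induct) (simp_all add: alg_const_def single_add)

lemma alg_const_commute: "a * alg_const c = alg_const c * a"
  by (induction a rule: free_alg_induct)
     (simp_all add: algebra_simps alg_const_def mult_single)

lemma alg_const_left_commute: "a * (alg_const c * b) = alg_const c * (a * b)"
  by (metis alg_const_commute mult.assoc)


section \<open>Congruence modulo a two-sided *-ideal\<close>

lemma finite_q_idx [simp]: "finite (q_idx X)"
proof (rule finite_subset)
  show "q_idx X \<subseteq> {..<length X} \<times> (\<Union>b<length X. {..<X ! b}) \<times> (\<Union>b<length X. {..<X ! b})"
    by (auto simp: q_idx_def)
qed auto

lemma free_carrier_0 [simp]: "0 \<in> free_carrier X"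
  by (simp add: free_carrier_def)

lemma free_carrier_single:
  "set (letters w) \<subseteq> gens X \<Longrightarrow> Poly_Mapping.single w c \<in> free_carrier X"
  by (simp add: free_carrier_def)

lemma free_carrier_const [simp]: "alg_const c \<in> free_carrier X"
  by (simp add: alg_const_def free_carrier_single zero_word_def)

lemma free_carrier_1 [simp]: "1 \<in> free_carrier X"
  using free_carrier_const[of 1] by simp

lemma free_carrier_add: "a \<in> free_carrier X \<Longrightarrow> b \<in> free_carrier X \<Longrightarrow> a + b \<in> free_carrier X"
  using keys_add[of a b] by (fastforce simp: free_carrier_def)

lemma free_carrier_sum:
  "(\<And>i. i \<in> I \<Longrightarrow> f i \<in> free_carrier X) \<Longrightarrow> sum f I \<in> free_carrier X"
  by (induction I rule: infinite_finite_induct) (auto intro: free_carrier_add)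

lemma free_carrier_mult: "a \<in> free_carrier X \<Longrightarrow> b \<in> free_carrier X \<Longrightarrow> a * b \<in> free_carrier X"
  using keys_mult[of a b] by (fastforce simp: free_carrier_def plus_word_def)

lemma free_carrier_u: "i \<in> q_idx X \<Longrightarrow> j \<in> q_idx X \<Longrightarrow> alg_u i j \<in> free_carrier X"
  unfolding alg_u_def by (rule free_carrier_single) (auto simp: gens_def)

lemma free_carrier_star:
  assumes "a \<in> free_carrier X"
  shows "alg_star a \<in> free_carrier X"
  unfolding free_carrier_def
proof clarify
  fix w :: "gen word" and g
  assume "w \<in> Poly_Mapping.keys (alg_star a)" and g: "g \<in> set (letters w)"
  then have "word_star w \<in> Poly_Mapping.keys a"
    by (simp add: in_keys_iff lookup_alg_star)
  with assms have "set (letters (word_star w)) \<subseteq> gens X"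
    by (auto simp: free_carrier_def)
  with g have "gen_star g \<in> gens X"
    by (auto simp: word_star_def)
  then show "g \<in> gens X"
    by (cases g) (auto simp: gens_def)
qed

definition cong_ideal :: "qset \<Rightarrow> free_star_alg set \<Rightarrow> free_star_alg \<Rightarrow> free_star_alg \<Rightarrow> bool" where
  "cong_ideal X S a b \<longleftrightarrow> a - b \<in> star_ideal X S"

lemma cong_ideal_refl [simp, intro]: "cong_ideal X S a a"
  by (simp add: cong_ideal_def star_ideal.zero)

lemma cong_ideal_trans [trans]:
  "cong_ideal X S a b \<Longrightarrow> cong_ideal X S b c \<Longrightarrow> cong_ideal X S a c"
  using star_ideal.add[of "a - b" X S "b - c"] by (simp add: cong_ideal_def)

lemma cong_ideal_sym:
  assumes "cong_ideal X S a b"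
  shows "cong_ideal X S b a"
proof -
  have "alg_const (-1) * (a - b) \<in> star_ideal X S"
    using assms by (intro star_ideal.left_mult) (auto simp: cong_ideal_def)
  moreover have "alg_const (-1) = -1"
    by (simp add: alg_const_def single_uminus)
  ultimately show ?thesis by (simp add: cong_ideal_def)
qed

lemma cong_ideal_add:
  "cong_ideal X S a b \<Longrightarrow> cong_ideal X S c d \<Longrightarrow> cong_ideal X S (a + c) (b + d)"
  using star_ideal.add[of "a - b" X S "c - d"] by (simp add: cong_ideal_def algebra_simps)

lemma cong_ideal_sum:
  "(\<And>i. i \<in> I \<Longrightarrow> cong_ideal X S (f i) (g i)) \<Longrightarrow> cong_ideal X S (sum f I) (sum g I)"
  by (induction I rule: infinite_finite_induct) (auto intro: cong_ideal_add)

lemma cong_ideal_mult_left: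
  "cong_ideal X S a b \<Longrightarrow> c \<in> free_carrier X \<Longrightarrow> cong_ideal X S (c * a) (c * b)"
  using star_ideal.left_mult[of "a - b" X S c] by (simp add: cong_ideal_def algebra_simps)

lemma cong_ideal_mult_right:
  "cong_ideal X S a b \<Longrightarrow> c \<in> free_carrier X \<Longrightarrow> cong_ideal X S (a * c) (b * c)"
  using star_ideal.right_mult[of "a - b" X S c] by (simp add: cong_ideal_def algebra_simps)

lemma cong_ideal_star: "cong_ideal X S a b \<Longrightarrow> cong_ideal X S (alg_star a) (alg_star b)"
  using star_ideal.star[of "a - b" X S] by (simp add: cong_ideal_def alg_star_diff)


section \<open>Sums over multi-indices\<close>

lemma finite_multi_idx [simp]: "finite (multi_idx X k)"
  using finite_lists_length_eq[of "q_idx X" k] by (simp add: multi_idx_def conj_commute)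

lemma multi_idx_0 [simp]: "multi_idx X 0 = {[]}"
  by (auto simp: multi_idx_def)

lemma length_multi_idx: "xs \<in> multi_idx X k \<Longrightarrow> length xs = k"
  by (simp add: multi_idx_def)

lemma append_in_multi_idx:
  "xs \<in> multi_idx X k \<Longrightarrow> ys \<in> multi_idx X l \<Longrightarrow> xs @ ys \<in> multi_idx X (k + l)"
  by (auto simp: multi_idx_def)

lemma in_multi_idx_addE:
  assumes "zs \<in> multi_idx X (k + l)"
  obtains xs ys where "zs = xs @ ys" "xs \<in> multi_idx X k" "ys \<in> multi_idx X l"
  using assms that[of "take k zs" "drop k zs"] set_take_subset[of k zs] set_drop_subset[of k zs]
  by (simp add: multi_idx_def) blast

lemma sum_multi_idx_add:
  "(\<Sum>zs\<in>multi_idx X (k + l). f zs) = (\<Sum>xs\<in>multi_idx X k. \<Sum>ys\<in>multi_idx X l. f (xs @ ys))"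
proof -
  have "(\<Sum>xs\<in>multi_idx X k. \<Sum>ys\<in>multi_idx X l. f (xs @ ys))
      = (\<Sum>(xs, ys)\<in>multi_idx X k \<times> multi_idx X l. f (xs @ ys))"
    by (simp add: sum.cartesian_product)
  also have "\<dots> = (\<Sum>zs\<in>multi_idx X (k + l). f zs)"
    by (rule sum.reindex_bij_witness[where i = "\<lambda>zs. (take k zs, drop k zs)" and j = "\<lambda>(xs, ys). xs @ ys"])
       (auto simp: length_multi_idx append_in_multi_idx elim!: in_multi_idx_addE)
  finally show ?thesis ..
qed

lemma multi_idx_1: "multi_idx X (Suc 0) = (\<lambda>p. [p]) ` q_idx X"
  by (auto simp: multi_idx_def length_Suc_conv)

lemma sum_multi_idx_1: "(\<Sum>zs\<in>multi_idx X (Suc 0). f zs) = (\<Sum>p\<in>q_idx X. f [p])"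
  by (simp add: multi_idx_1 sum.reindex inj_on_def)

lemma sum_multi_idx_Suc:
  "(\<Sum>zs\<in>multi_idx X (Suc k). f zs) = (\<Sum>p\<in>q_idx X. \<Sum>ys\<in>multi_idx X k. f (p # ys))"
  using sum_multi_idx_add[where k = "Suc 0" and l = k and X = X and f = f] by (simp add: sum_multi_idx_1)

lemma sum_multi_idx_2: "(\<Sum>zs\<in>multi_idx X 2. f zs) = (\<Sum>p\<in>q_idx X. \<Sum>q\<in>q_idx X. f [p, q])"
  by (simp add: numeral_2_eq_2 sum_multi_idx_Suc)


section \<open>Closure properties of the intertwiner spaces\<close>

definition aut_relators :: "qset \<Rightarrow> (qelem \<Rightarrow> qelem) \<Rightarrow> free_star_alg set" where
  "aut_relators X A = unitarity_relators X \<union> conjugation_relators X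
     \<union> defects X 2 1 (mult_op X) \<union> defects X 1 1 (lin_op X A)"

abbreviation aut_cong :: "qset \<Rightarrow> (qelem \<Rightarrow> qelem) \<Rightarrow> free_star_alg \<Rightarrow> free_star_alg \<Rightarrow> bool" where
  "aut_cong X A \<equiv> cong_ideal X (aut_relators X A)"

lemma u_tensor_Nil [simp]: "u_tensor [] [] = 1"
  by (simp add: u_tensor_def)

lemma u_tensor_Cons [simp]: "u_tensor (y # ys) (x # xs) = alg_u y x * u_tensor ys xs"
  by (simp add: u_tensor_def)

lemma u_tensor_append:
  "length ys = length xs \<Longrightarrow>
   u_tensor (ys @ ys') (xs @ xs') = u_tensor ys xs * u_tensor ys' xs'"
  by (simp add: u_tensor_def)

lemma multi_idx_SucE:
  assumes "zs \<in> multi_idx X (Suc k)"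
  obtains y ys where "zs = y # ys" "y \<in> q_idx X" "ys \<in> multi_idx X k"
  using assms by (auto simp: multi_idx_def length_Suc_conv)

lemma free_carrier_u_tensor:
  "ys \<in> multi_idx X k \<Longrightarrow> xs \<in> multi_idx X k \<Longrightarrow> u_tensor ys xs \<in> free_carrier X"
proof (induction k arbitrary: xs ys)
  case (Suc k)
  then show ?case
    by (auto elim!: multi_idx_SucE intro!: free_carrier_mult free_carrier_u)
qed simp

lemma intertwiners_iff:
  "T \<in> intertwiners X A k l \<longleftrightarrow> T \<in> ops X k l \<and>
     (\<forall>ys\<in>multi_idx X l. \<forall>xs\<in>multi_idx X k. aut_cong X A
        (\<Sum>zs\<in>multi_idx X k. alg_const (T ys zs) * u_tensor zs xs)
        (\<Sum>zs\<in>multi_idx X l. u_tensor ys zs * alg_const (T zs xs)))"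
proof -
  have "defects X k l T \<subseteq> I \<longleftrightarrow>
      (\<forall>ys\<in>multi_idx X l. \<forall>xs\<in>multi_idx X k. intertwiner_defect X k l T ys xs \<in> I)" for I
    by (auto simp: defects_def)
  then show ?thesis
    by (simp add: intertwiners_def intertwiner_defect_def cong_ideal_def aut_ideal_def
        aut_relators_def)
qed

lemma ops_op_comp:
  "S \<in> ops X k l \<Longrightarrow> T \<in> ops X j k \<Longrightarrow> op_comp X k S T \<in> ops X j l"
  by (auto simp: ops_def op_comp_def)

text \<open>
  Modulo the relations, \<open>S T u = S u T = u S T\<close>.
\<close>

lemma intertwiners_comp:
  assumes S: "S \<in> intertwiners X A k l" and T: "T \<in> intertwiners X A j k"
  shows "op_comp X k S T \<in> intertwiners X A j l"
  unfolding intertwiners_iff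
proof (intro conjI ballI)
  show "op_comp X k S T \<in> ops X j l"
    using S T by (auto simp: intertwiners_def intro: ops_op_comp)
next
  fix ys xs assume ys: "ys \<in> multi_idx X l" and xs: "xs \<in> multi_idx X j"
  let ?c = alg_const
  have "(\<Sum>zs\<in>multi_idx X j. ?c (op_comp X k S T ys zs) * u_tensor zs xs)
      = (\<Sum>zs\<in>multi_idx X j. \<Sum>ws\<in>multi_idx X k. ?c (S ys ws) * (?c (T ws zs) * u_tensor zs xs))"
    by (simp add: op_comp_def alg_const_sum alg_const_mult sum_distrib_right mult.assoc)
  also have "\<dots> = (\<Sum>ws\<in>multi_idx X k. ?c (S ys ws) *
                   (\<Sum>zs\<in>multi_idx X j. ?c (T ws zs) * u_tensor zs xs))"
    by (subst sum.swap) (simp add: sum_distrib_left)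
  also have "aut_cong X A \<dots>
      (\<Sum>ws\<in>multi_idx X k. ?c (S ys ws) * (\<Sum>vs\<in>multi_idx X k. u_tensor ws vs * ?c (T vs xs)))"
    using T xs by (intro cong_ideal_sum cong_ideal_mult_left) (auto simp: intertwiners_iff)
  also have "\<dots> = (\<Sum>ws\<in>multi_idx X k. \<Sum>vs\<in>multi_idx X k. ?c (S ys ws) * u_tensor ws vs * ?c (T vs xs))"
    by (simp add: sum_distrib_left mult.assoc)
  also have "\<dots> = (\<Sum>vs\<in>multi_idx X k. (\<Sum>ws\<in>multi_idx X k. ?c (S ys ws) * u_tensor ws vs) * ?c (T vs xs))"
    by (subst sum.swap) (simp add: sum_distrib_right)
  also have "aut_cong X A \<dots>
      (\<Sum>vs\<in>multi_idx X k. (\<Sum>zs\<in>multi_idx X l. u_tensor ys zs * ?c (S zs vs)) * ?c (T vs xs))"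
    using S ys by (intro cong_ideal_sum cong_ideal_mult_right) (auto simp: intertwiners_iff)
  also have "\<dots> = (\<Sum>vs\<in>multi_idx X k. \<Sum>zs\<in>multi_idx X l. u_tensor ys zs * (?c (S zs vs) * ?c (T vs xs)))"
    by (simp add: sum_distrib_right mult.assoc)
  also have "\<dots> = (\<Sum>zs\<in>multi_idx X l. u_tensor ys zs * ?c (op_comp X k S T zs xs))"
    by (subst sum.swap) (simp add: op_comp_def alg_const_sum alg_const_mult sum_distrib_left)
  finally show "aut_cong X A
      (\<Sum>zs\<in>multi_idx X j. ?c (op_comp X k S T ys zs) * u_tensor zs xs)
      (\<Sum>zs\<in>multi_idx X l. u_tensor ys zs * ?c (op_comp X k S T zs xs))" .
qed

lemma take_drop_notin_multi_idx:
  assumes "zs \<notin> multi_idx X (k + l)"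
  shows "take k zs \<notin> multi_idx X k \<or> drop k zs \<notin> multi_idx X l"
  using assms append_in_multi_idx[of "take k zs" X k "drop k zs" l] by auto

lemma ops_op_tensor:
  "S \<in> ops X k l \<Longrightarrow> T \<in> ops X k' l' \<Longrightarrow> op_tensor k l S T \<in> ops X (k + k') (l + l')"
  unfolding ops_def op_tensor_def using take_drop_notin_multi_idx by fastforce

lemma op_tensor_append:
  "length ys = l \<Longrightarrow> length xs = k \<Longrightarrow>
   op_tensor k l S T (ys @ ys') (xs @ xs') = S ys xs * T ys' xs'"
  by (simp add: op_tensor_def)

text \<open>
  Since \<open>u\<close> is multiplicative over concatenation of indices and scalars are central,
  \<open>(S \<otimes> T)(u \<otimes> u) = S u \<otimes> T u\<close>, and both factors may be rewritten separately.
\<close>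

lemma intertwiners_tensor:
  assumes S: "S \<in> intertwiners X A k l" and T: "T \<in> intertwiners X A k' l'"
  shows "op_tensor k l S T \<in> intertwiners X A (k + k') (l + l')"
  unfolding intertwiners_iff
proof (intro conjI ballI)
  show "op_tensor k l S T \<in> ops X (k + k') (l + l')"
    using S T by (auto simp: intertwiners_def intro: ops_op_tensor)
next
  fix ys0 xs0 assume "ys0 \<in> multi_idx X (l + l')" and "xs0 \<in> multi_idx X (k + k')"
  then obtain ys ys' xs xs' where ys0: "ys0 = ys @ ys'" and xs0: "xs0 = xs @ xs'"
    and ys: "ys \<in> multi_idx X l" and ys': "ys' \<in> multi_idx X l'"
    and xs: "xs \<in> multi_idx X k" and xs': "xs' \<in> multi_idx X k'"
    by (elim in_multi_idx_addE)
  let ?c = alg_const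
  note simps = length_multi_idx[OF ys] length_multi_idx[OF xs]
    op_tensor_append u_tensor_append alg_const_mult mult.assoc
    alg_const_commute[of "u_tensor vs ws" for vs ws]
    alg_const_left_commute[of "u_tensor vs ws" for vs ws]
  have "(\<Sum>zs\<in>multi_idx X (k + k'). ?c (op_tensor k l S T ys0 zs) * u_tensor zs xs0)
      = (\<Sum>zs\<in>multi_idx X k. \<Sum>zs'\<in>multi_idx X k'.
           (?c (S ys zs) * u_tensor zs xs) * (?c (T ys' zs') * u_tensor zs' xs'))"
    unfolding ys0 xs0 sum_multi_idx_add by (intro sum.cong refl) (auto simp: simps dest!: length_multi_idx)
  also have "\<dots> = (\<Sum>zs\<in>multi_idx X k. ?c (S ys zs) * u_tensor zs xs) *
                  (\<Sum>zs'\<in>multi_idx X k'. ?c (T ys' zs') * u_tensor zs' xs')"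
    by (simp add: sum_product)
  also have "aut_cong X A \<dots>
      ((\<Sum>zs\<in>multi_idx X l. u_tensor ys zs * ?c (S zs xs)) *
       (\<Sum>zs'\<in>multi_idx X k'. ?c (T ys' zs') * u_tensor zs' xs'))"
    using S ys xs xs'
    by (intro cong_ideal_mult_right free_carrier_sum free_carrier_mult)
       (auto simp: intertwiners_iff intro: free_carrier_u_tensor)
  also have "aut_cong X A \<dots>
      ((\<Sum>zs\<in>multi_idx X l. u_tensor ys zs * ?c (S zs xs)) *
       (\<Sum>zs'\<in>multi_idx X l'. u_tensor ys' zs' * ?c (T zs' xs')))"
    using T ys ys' xs'
    by (intro cong_ideal_mult_left free_carrier_sum free_carrier_mult)
       (auto simp: intertwiners_iff intro: free_carrier_u_tensor)
  also have "\<dots> = (\<Sum>zs\<in>multi_idx X l. \<Sum>zs'\<in>multi_idx X l'.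
           (u_tensor ys zs * ?c (S zs xs)) * (u_tensor ys' zs' * ?c (T zs' xs')))"
    by (simp add: sum_product)
  also have "\<dots> = (\<Sum>zs\<in>multi_idx X (l + l'). u_tensor ys0 zs * ?c (op_tensor k l S T zs xs0))"
    unfolding ys0 xs0 sum_multi_idx_add by (intro sum.cong refl) (auto simp: simps dest!: length_multi_idx)
  finally show "aut_cong X A
      (\<Sum>zs\<in>multi_idx X (k + k'). ?c (op_tensor k l S T ys0 zs) * u_tensor zs xs0)
      (\<Sum>zs\<in>multi_idx X (l + l'). u_tensor ys0 zs * ?c (op_tensor k l S T zs xs0))" .
qed

lemma u_cong_unitary:
  assumes "i \<in> q_idx X" "j \<in> q_idx X"
  shows "aut_cong X A (\<Sum>k\<in>q_idx X. alg_u i k * alg_star (alg_u j k)) (if i = j then 1 else 0)"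
    and "aut_cong X A (\<Sum>k\<in>q_idx X. alg_star (alg_u k i) * alg_u k j) (if i = j then 1 else 0)"
proof -
  have "(\<Sum>k\<in>q_idx X. alg_u i k * alg_star (alg_u j k)) - (if i = j then 1 else 0)
      \<in> unitarity_relators X"
    unfolding unitarity_relators_def using assms by (intro UnI1 CollectI exI[of _ i] exI[of _ j] conjI refl)
  then show "aut_cong X A (\<Sum>k\<in>q_idx X. alg_u i k * alg_star (alg_u j k)) (if i = j then 1 else 0)"
    unfolding cong_ideal_def aut_relators_def by (intro star_ideal.relator UnI1)
  have "(\<Sum>k\<in>q_idx X. alg_star (alg_u k i) * alg_u k j) - (if i = j then 1 else 0)
      \<in> unitarity_relators X"
    unfolding unitarity_relators_def using assms by (intro UnI2 CollectI exI[of _ i] exI[of _ j] conjI refl)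
  then show "aut_cong X A (\<Sum>k\<in>q_idx X. alg_star (alg_u k i) * alg_u k j) (if i = j then 1 else 0)"
    unfolding cong_ideal_def aut_relators_def by (intro star_ideal.relator UnI1)
qed

text \<open>
  In a tensor power the unitarity relation for the last factors collapses first, leaving the
  relation for the first factor; in the product with the star on the left it is the other way
  round. This is why the two halves are separate inductions.
\<close>

lemma u_tensor_unitary_right:
  assumes "ys \<in> multi_idx X k" "xs \<in> multi_idx X k"
  shows "aut_cong X A (\<Sum>zs\<in>multi_idx X k. u_tensor ys zs * alg_star (u_tensor xs zs))
           (if ys = xs then 1 else 0)"
  using assms
proof (induction k arbitrary: ys xs)
  case (Suc k)
  obtain y ys' x xs' where ys: "ys = y # ys'" and xs: "xs = x # xs'"
    and mem: "y \<in> q_idx X" "x \<in> q_idx X" "ys' \<in> multi_idx X k" "xs' \<in> multi_idx X k"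
    using Suc.prems by (metis multi_idx_SucE)
  have "(\<Sum>zs\<in>multi_idx X (Suc k). u_tensor ys zs * alg_star (u_tensor xs zs))
      = (\<Sum>z\<in>q_idx X. alg_u y z *
           (\<Sum>zs\<in>multi_idx X k. u_tensor ys' zs * alg_star (u_tensor xs' zs)) * alg_star (alg_u x z))"
    by (simp add: ys xs sum_multi_idx_Suc alg_star_mult sum_distrib_left sum_distrib_right mult.assoc)
  also have "aut_cong X A \<dots>
      (\<Sum>z\<in>q_idx X. alg_u y z * (if ys' = xs' then 1 else 0) * alg_star (alg_u x z))"
    using mem Suc.IH
    by (intro cong_ideal_sum cong_ideal_mult_left cong_ideal_mult_right)
       (auto intro: free_carrier_u free_carrier_star)
  also have "\<dots> = (if ys' = xs' then \<Sum>z\<in>q_idx X. alg_u y z * alg_star (alg_u x z) else 0)"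
    by simp
  also have "aut_cong X A \<dots> (if ys = xs then 1 else 0)"
    using u_cong_unitary(1)[OF mem(1,2), of A] by (auto simp: ys xs)
  finally show ?case .
qed simp

lemma u_tensor_unitary_left:
  assumes "ys \<in> multi_idx X k" "xs \<in> multi_idx X k"
  shows "aut_cong X A (\<Sum>zs\<in>multi_idx X k. alg_star (u_tensor zs ys) * u_tensor zs xs)
           (if ys = xs then 1 else 0)"
  using assms
proof (induction k arbitrary: ys xs)
  case (Suc k)
  obtain y ys' x xs' where ys: "ys = y # ys'" and xs: "xs = x # xs'"
    and mem: "y \<in> q_idx X" "x \<in> q_idx X" "ys' \<in> multi_idx X k" "xs' \<in> multi_idx X k"
    using Suc.prems by (metis multi_idx_SucE)
  have "(\<Sum>zs\<in>multi_idx X (Suc k). alg_star (u_tensor zs ys) * u_tensor zs xs)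
      = (\<Sum>z\<in>q_idx X. \<Sum>zs\<in>multi_idx X k.
           alg_star (u_tensor zs ys') * (alg_star (alg_u z y) * alg_u z x) * u_tensor zs xs')"
    by (simp add: ys xs sum_multi_idx_Suc alg_star_mult mult.assoc)
  also have "\<dots> = (\<Sum>zs\<in>multi_idx X k.
           alg_star (u_tensor zs ys') * (\<Sum>z\<in>q_idx X. alg_star (alg_u z y) * alg_u z x) * u_tensor zs xs')"
    by (subst sum.swap) (simp add: sum_distrib_left sum_distrib_right)
  also have "aut_cong X A \<dots>
      (\<Sum>zs\<in>multi_idx X k. alg_star (u_tensor zs ys') * (if y = x then 1 else 0) * u_tensor zs xs')"
    using mem u_cong_unitary(2)[OF mem(1,2), of A]
    by (intro cong_ideal_sum cong_ideal_mult_left cong_ideal_mult_right)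
       (auto intro: free_carrier_u_tensor free_carrier_star)
  also have "\<dots> = (if y = x then \<Sum>zs\<in>multi_idx X k. alg_star (u_tensor zs ys') * u_tensor zs xs' else 0)"
    by simp
  also have "aut_cong X A \<dots> (if ys = xs then 1 else 0)"
    using Suc.IH[OF mem(3,4)] by (auto simp: ys xs)
  finally show ?case .
qed simp

text \<open>
  Multiplying \<open>T u = u T\<close> by \<open>u\<^sup>*\<close> from both sides gives \<open>u\<^sup>* T = T u\<^sup>*\<close> because the tensor powers of \<open>u\<close>
  are unitary; the star of this relation is the claim. In the proof \<open>?V\<close> and \<open>?W\<close> are the
  relevant row and column of \<open>u\<^sup>*\<close>.
\<close>

lemma intertwiners_dagger:
  assumes T: "T \<in> intertwiners X A k l"
  shows "op_dagger T \<in> intertwiners X A l k"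
  unfolding intertwiners_iff
proof (intro conjI ballI)
  show "op_dagger T \<in> ops X l k"
    using T by (auto simp: intertwiners_def ops_def op_dagger_def)
next
  fix ys xs assume ys: "ys \<in> multi_idx X k" and xs: "xs \<in> multi_idx X l"
  let ?c = alg_const and ?K = "multi_idx X k" and ?L = "multi_idx X l"
  let ?V = "\<lambda>vs. alg_star (u_tensor vs xs)" and ?W = "\<lambda>vs. alg_star (u_tensor ys vs)"
  have V: "?V vs \<in> free_carrier X" if "vs \<in> ?L" for vs
    using that xs by (intro free_carrier_star free_carrier_u_tensor)
  have W: "?W vs \<in> free_carrier X" if "vs \<in> ?K" for vs
    using that ys by (intro free_carrier_star free_carrier_u_tensor)
  have "(\<Sum>p\<in>?L. ?V p * ?c (T p ys)) =
        (\<Sum>p\<in>?L. \<Sum>r\<in>?K. ?V p * ?c (T p r) * (if r = ys then 1 else 0))"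
    using ys by (simp add: if_distrib[of "\<lambda>x. _ * x"] cong: if_cong)
  also have "aut_cong X A \<dots>
      (\<Sum>p\<in>?L. \<Sum>r\<in>?K. ?V p * ?c (T p r) * (\<Sum>q\<in>?K. u_tensor r q * ?W q))"
    using ys V
    by (intro cong_ideal_sum cong_ideal_mult_left free_carrier_mult
          cong_ideal_sym[OF u_tensor_unitary_right]) auto
  also have "\<dots> = (\<Sum>p\<in>?L. \<Sum>r\<in>?K. \<Sum>q\<in>?K. ?V p * (?c (T p r) * u_tensor r q) * ?W q)"
    by (simp add: sum_distrib_left mult.assoc)
  also have "\<dots> = (\<Sum>p\<in>?L. \<Sum>q\<in>?K. ?V p * (\<Sum>r\<in>?K. ?c (T p r) * u_tensor r q) * ?W q)"
    by (subst sum.swap) (simp add: sum_distrib_left sum_distrib_right)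
  also have "aut_cong X A \<dots>
      (\<Sum>p\<in>?L. \<Sum>q\<in>?K. ?V p * (\<Sum>r\<in>?L. u_tensor p r * ?c (T r q)) * ?W q)"
    using T V W
    by (intro cong_ideal_sum cong_ideal_mult_left cong_ideal_mult_right)
       (auto simp: intertwiners_iff)
  also have "\<dots> = (\<Sum>p\<in>?L. \<Sum>q\<in>?K. \<Sum>r\<in>?L. (?V p * u_tensor p r) * ?c (T r q) * ?W q)"
    by (simp add: sum_distrib_left sum_distrib_right mult.assoc)
  also have "\<dots> = (\<Sum>q\<in>?K. \<Sum>p\<in>?L. \<Sum>r\<in>?L. (?V p * u_tensor p r) * ?c (T r q) * ?W q)"
    by (rule sum.swap)
  also have "\<dots> = (\<Sum>q\<in>?K. \<Sum>r\<in>?L. (\<Sum>p\<in>?L. ?V p * u_tensor p r) * (?c (T r q) * ?W q))"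
    by (rule sum.cong, rule refl, subst sum.swap) (simp add: sum_distrib_right mult.assoc)
  also have "aut_cong X A \<dots>
      (\<Sum>q\<in>?K. \<Sum>r\<in>?L. (if xs = r then 1 else 0) * (?c (T r q) * ?W q))"
    using xs W
    by (intro cong_ideal_sum cong_ideal_mult_right free_carrier_mult u_tensor_unitary_left) auto
  also have "\<dots> = (\<Sum>q\<in>?K. ?c (T xs q) * ?W q)"
    using xs by (simp add: if_distrib[of "\<lambda>x. x * _"] cong: if_cong)
  finally have "aut_cong X A (alg_star (\<Sum>p\<in>?L. ?V p * ?c (T p ys)))
                             (alg_star (\<Sum>q\<in>?K. ?c (T xs q) * ?W q))"
    by (rule cong_ideal_star)
  then show "aut_cong X A
      (\<Sum>zs\<in>?L. ?c (op_dagger T ys zs) * u_tensor zs xs)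
      (\<Sum>zs\<in>?K. u_tensor ys zs * ?c (op_dagger T zs xs))"
    by (simp add: alg_star_sum alg_star_mult alg_star_const op_dagger_def)
qed

lemma intertwiners_mult_op: "mult_op X \<in> intertwiners X A 2 1"
  by (auto simp: intertwiners_def aut_ideal_def mult_op_def ops_def mk_op_def
      intro: star_ideal.relator)

lemma intertwiners_lin_op: "lin_op X A \<in> intertwiners X A 1 1"
  by (auto simp: intertwiners_def aut_ideal_def lin_op_def ops_def mk_op_def
      intro: star_ideal.relator)


section \<open>The Schur product\<close>

text \<open>
  For functions on a finite set this is the entrywise product of matrices.
\<close>

definition schur_product :: "qset \<Rightarrow> op_matrix \<Rightarrow> op_matrix \<Rightarrow> op_matrix" where
  "schur_product X S T =
     op_comp X 2 (mult_op X) (op_comp X 2 (op_tensor 1 1 S T) (op_dagger (mult_op X)))"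

lemma schur_product_eq:
  "schur_product X S T zs xs =
     (\<Sum>p\<in>q_idx X. \<Sum>q\<in>q_idx X. \<Sum>r\<in>q_idx X. \<Sum>s\<in>q_idx X.
        mult_op X zs [p, q] * (S [p] [r] * T [q] [s] * cnj (mult_op X xs [r, s])))"
  by (simp add: schur_product_def op_comp_def sum_multi_idx_2 op_tensor_def op_dagger_def
      sum_distrib_left)

lemma q_basis_in_q_carrier: "q_basis X p \<in> q_carrier X"
  by (cases p) (auto simp: q_carrier_def)

lemma mult_op_commute:
  assumes "q_commutative X"
  shows "mult_op X ys [p, q] = mult_op X ys [q, p]"
proof -
  have "q_mult (q_basis X p) (q_basis X q) = q_mult (q_basis X q) (q_basis X p)"
    using assms q_basis_in_q_carrier by (auto simp: q_commutative_def)
  then show ?thesis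
    by (simp add: mult_op_def mk_op_def multi_idx_def conj_commute)
qed

text \<open>
  For commutative \<open>m\<close> the flip \<open>\<sigma>\<close> satisfies \<open>m \<sigma> = m\<close> and \<open>\<sigma> m\<^sup>\<dagger> = m\<^sup>\<dagger>\<close>, and it turns \<open>S \<otimes> T\<close> into
  \<open>T \<otimes> S\<close>. The flip itself need not be an intertwiner, but it is only needed on the commutative
  side, where the identity is one between plain matrices.
\<close>

lemma schur_product_commute:
  assumes "q_commutative X"
  shows "schur_product X S T = schur_product X T S"
proof (intro ext)
  fix zs xs
  let ?m = "mult_op X"
  have "schur_product X S T zs xs =
     (\<Sum>p\<in>q_idx X. \<Sum>q\<in>q_idx X. \<Sum>s\<in>q_idx X. \<Sum>r\<in>q_idx X.
        ?m zs [p, q] * (S [p] [r] * T [q] [s] * cnj (?m xs [r, s])))"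
    unfolding schur_product_eq by (intro sum.cong refl sum.swap)
  also have "\<dots> = (\<Sum>q\<in>q_idx X. \<Sum>p\<in>q_idx X. \<Sum>s\<in>q_idx X. \<Sum>r\<in>q_idx X.
        ?m zs [p, q] * (S [p] [r] * T [q] [s] * cnj (?m xs [r, s])))"
    by (rule sum.swap)
  also have "\<dots> = (\<Sum>q\<in>q_idx X. \<Sum>p\<in>q_idx X. \<Sum>s\<in>q_idx X. \<Sum>r\<in>q_idx X.
        ?m zs [q, p] * (T [q] [s] * S [p] [r] * cnj (?m xs [s, r])))"
    by (intro sum.cong refl arg_cong2[of _ _ _ _ times] arg_cong[of _ _ cnj]
          mult_op_commute assms mult.commute)
  finally show "schur_product X S T zs xs = schur_product X T S zs xs"
    by (simp add: schur_product_eq)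
qed


section \<open>Structure constants of a full matrix algebra\<close>

lemma q_idx_quantum_M: "q_idx (quantum_M n) = {0} \<times> {..<n} \<times> {..<n}"
  by (auto simp: q_idx_def quantum_M_def)

lemma sum_q_idx_quantum_M:
  "(\<Sum>p\<in>q_idx (quantum_M n). f p) = (\<Sum>i<n. \<Sum>j<n. f (0, i, j))"
  by (simp add: q_idx_quantum_M sum.cartesian_product')

lemma mem_q_idx_quantum_M [simp]:
  "(b, i, j) \<in> q_idx (quantum_M n) \<longleftrightarrow> b = 0 \<and> i < n \<and> j < n"
  by (auto simp: q_idx_def quantum_M_def)

lemma q_carrier_quantum_M: "q_carrier (quantum_M n) = (\<lambda>a. [a]) ` carrier_mat n n"
  by (auto simp: q_carrier_def quantum_M_def length_Suc_conv)

definition unit_mat_scaled :: "nat \<Rightarrow> nat \<Rightarrow> nat \<Rightarrow> complex mat" where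
  "unit_mat_scaled n i j = mat n n (\<lambda>(k, l). if k = i \<and> l = j then 1 / complex_of_real (sqrt n) else 0)"

lemma unit_mat_scaled_carrier [simp]: "unit_mat_scaled n i j \<in> carrier_mat n n"
  by (simp add: unit_mat_scaled_def)

lemma unit_mat_scaled_index [simp]:
  "k < n \<Longrightarrow> l < n \<Longrightarrow> unit_mat_scaled n i j $$ (k, l)
     = (if k = i \<and> l = j then 1 / complex_of_real (sqrt n) else 0)"
  by (simp add: unit_mat_scaled_def)

lemma unit_mat_scaled_dim [simp]:
  "dim_row (unit_mat_scaled n i j) = n" "dim_col (unit_mat_scaled n i j) = n"
  by (simp_all add: unit_mat_scaled_def)

lemma q_basis_quantum_M: "q_basis (quantum_M n) (0, i, j) = [unit_mat_scaled n i j]"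
  by (simp add: q_basis.simps quantum_M_def unit_mat_scaled_def cong: if_cong)

text \<open>
  The basis vectors stay folded from here on, so that their products and adjoints are rewritten
  by their structure constants.
\<close>

declare q_basis.simps [simp del]

lemma mat_adjoint_index:
  fixes a :: "complex mat"
  shows "a \<in> carrier_mat n m \<Longrightarrow> i < m \<Longrightarrow> j < n \<Longrightarrow> mat_adjoint a $$ (i, j) = cnj (a $$ (j, i))"
  by (simp add: mat_adjoint_def mat_of_rows_def)

lemma mat_adjoint_carrier:
  fixes a :: "complex mat"
  shows "a \<in> carrier_mat n m \<Longrightarrow> mat_adjoint a \<in> carrier_mat m n"
  by (simp add: mat_adjoint_def mat_of_rows_def)

lemma of_real_sqrt_nat: "complex_of_real (sqrt (real n)) * complex_of_real (sqrt (real n)) = of_nat n"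
  by (simp flip: of_real_mult)

lemma q_coord_quantum_M:
  assumes "i < n" "j < n" "a \<in> carrier_mat n n"
  shows "q_coord (quantum_M n) (0, i, j) [a] = complex_of_real (sqrt n) * a $$ (i, j)"
proof -
  let ?e = "unit_mat_scaled n i j"
  let ?s = "complex_of_real (sqrt n)"
  have "(mat_adjoint ?e * a) $$ (k, k) = (if k = j then a $$ (i, j) / ?s else 0)" if "k < n" for k
  proof -
    have "(mat_adjoint ?e * a) $$ (k, k) = (\<Sum>l<n. mat_adjoint ?e $$ (k, l) * a $$ (l, k))"
      using that assms mat_adjoint_carrier[OF unit_mat_scaled_carrier[of n i j]]
      by (simp add: scalar_prod_def atLeast0LessThan)
    also have "\<dots> = (\<Sum>l<n. if l = i then (if k = j then a $$ (i, j) / ?s else 0) else 0)"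
      using that assms
      by (intro sum.cong refl) (auto simp: mat_adjoint_index[OF unit_mat_scaled_carrier])
    finally show ?thesis
      using assms by simp
  qed
  then have "(\<Sum>k<n. (mat_adjoint ?e * a) $$ (k, k)) = a $$ (i, j) / ?s"
    using assms by simp
  then have "q_coord (quantum_M n) (0, i, j) [a] = of_nat n * (a $$ (i, j) / ?s)"
    by (simp add: q_coord_def q_inner_def q_counit_def q_basis_quantum_M q_star_def q_mult_def)
       (simp add: quantum_M_def)
  also have "\<dots> = ?s * a $$ (i, j)"
    using assms by (simp add: field_simps flip: of_real_sqrt_nat)
  finally show ?thesis .
qed

lemma q_coord_mult_quantum_M:
  assumes "a < n" "b < n" "i < n" "j < n" "k < n" "l < n"
  shows "q_coord (quantum_M n) (0, a, b)
           (q_mult (q_basis (quantum_M n) (0, i, j)) (q_basis (quantum_M n) (0, k, l)))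
         = (if a = i \<and> b = l \<and> j = k then 1 / complex_of_real (sqrt n) else 0)"
proof -
  let ?s = "complex_of_real (sqrt n)"
  have "(unit_mat_scaled n i j * unit_mat_scaled n k l) $$ (a, b) =
        (\<Sum>c<n. unit_mat_scaled n i j $$ (a, c) * unit_mat_scaled n k l $$ (c, b))"
    using assms by (auto simp: scalar_prod_def atLeast0LessThan intro!: sum.cong)
  also have "\<dots> = (\<Sum>c<n. if c = k then (if a = i \<and> b = l \<and> j = k then 1 / (?s * ?s) else 0) else 0)"
    using assms by (intro sum.cong refl) auto
  also have "\<dots> = (if a = i \<and> b = l \<and> j = k then 1 / (?s * ?s) else 0)"
    using assms by simp
  finally have "(unit_mat_scaled n i j * unit_mat_scaled n k l) $$ (a, b)
      = (if a = i \<and> b = l \<and> j = k then 1 / (?s * ?s) else 0)" .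
  moreover have "unit_mat_scaled n i j * unit_mat_scaled n k l \<in> carrier_mat n n"
    by (rule mult_carrier_mat[OF unit_mat_scaled_carrier unit_mat_scaled_carrier])
  ultimately show ?thesis
    using assms by (simp add: q_basis_quantum_M q_mult_def q_coord_quantum_M del: index_mult_mat)
qed

lemma q_coord_star_quantum_M:
  assumes "a < n" "b < n" "i < n" "j < n"
  shows "q_coord (quantum_M n) (0, a, b) (q_star (q_basis (quantum_M n) (0, i, j)))
         = (if a = j \<and> b = i then 1 else 0)"
proof -
  show ?thesis
    using assms mat_adjoint_carrier[OF unit_mat_scaled_carrier] mat_adjoint_index[OF unit_mat_scaled_carrier]
    by (auto simp add: q_basis_quantum_M q_star_def q_coord_quantum_M)
qed

lemma q_coord_one_quantum_M:
  assumes "a < n" "b < n"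
  shows "q_coord (quantum_M n) (0, a, b) (q_one (quantum_M n))
         = (if a = b then complex_of_real (sqrt n) else 0)"
  using assms by (simp add: q_one_def quantum_M_def q_coord_quantum_M[unfolded quantum_M_def])

lemma mult_op_quantum_M:
  assumes "a < n" "b < n" "i < n" "j < n" "k < n" "l < n"
  shows "mult_op (quantum_M n) [(0, a, b)] [(0, i, j), (0, k, l)]
         = (if a = i \<and> b = l \<and> j = k then 1 / complex_of_real (sqrt n) else 0)"
  using assms by (simp add: mult_op_def mk_op_def multi_idx_def q_coord_mult_quantum_M)

lemma unit_op_quantum_M:
  assumes "a < n" "b < n"
  shows "unit_op (quantum_M n) [(0, a, b)] [] = (if a = b then complex_of_real (sqrt n) else 0)"
  using assms by (simp add: unit_op_def mk_op_def multi_idx_def q_coord_one_quantum_M)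


section \<open>Conjugation by a diagonal matrix as a quantum graph\<close>

text \<open>
  The vectors \<open>\<Sum> t\<^sub>i\<^sub>j e\<^sub>i\<^sub>j \<otimes> e\<^sub>j\<^sub>i\<close>. They form a *-subalgebra of \<open>M\<^sub>n \<otimes> M\<^sub>n\<^sup>o\<^sup>p\<close> in which the product is the
  matrix product of the coefficients divided by \<open>n\<close> and the star is their conjugate transpose,
  so that statements about edge projections become statements about \<open>n \<times> n\<close> matrices.
\<close>

definition flip_vector :: "nat \<Rightarrow> (nat \<Rightarrow> nat \<Rightarrow> complex) \<Rightarrow> op_matrix \<Rightarrow> bool" where
  "flip_vector n t T \<longleftrightarrow> T \<in> ops (quantum_M n) 0 2 \<and>
     (\<forall>i<n. \<forall>j<n. \<forall>k<n. \<forall>l<n.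
        T [(0, i, j), (0, k, l)] [] = (if k = j \<and> l = i then t i j else 0))"

definition diagonal_op :: "nat \<Rightarrow> (nat \<Rightarrow> nat \<Rightarrow> complex) \<Rightarrow> op_matrix \<Rightarrow> bool" where
  "diagonal_op n s S \<longleftrightarrow>
     (\<forall>i<n. \<forall>j<n. \<forall>k<n. \<forall>l<n.
        S [(0, i, j)] [(0, k, l)] = (if k = i \<and> l = j then s i j else 0))"

lemma sum_delta_pair:
  fixes f :: "nat \<Rightarrow> nat \<Rightarrow> complex"
  assumes "i < n" "j < n"
  shows "(\<Sum>k<n. \<Sum>l<n. if k = i \<and> l = j then f k l else 0) = f i j"
proof -
  have "(\<Sum>l<n. if k = i \<and> l = j then f k l else 0) = (if k = i then f k j else 0)" for k
    using assms by simp
  then show ?thesis using assms by simp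
qed

lemma sum_flip_vector:
  assumes "flip_vector n t T" "i < n" "j < n"
  shows "(\<Sum>q\<in>q_idx (quantum_M n). T [(0, i, j), q] [] * h q) = t i j * h (0, j, i)"
proof -
  have "(\<Sum>q\<in>q_idx (quantum_M n). T [(0, i, j), q] [] * h q)
      = (\<Sum>k<n. \<Sum>l<n. if k = j \<and> l = i then t i j * h (0, k, l) else 0)"
    unfolding sum_q_idx_quantum_M using assms
    by (intro sum.cong refl) (simp add: flip_vector_def)
  then show ?thesis using assms by (simp add: sum_delta_pair)
qed

lemma sum_diagonal_op:
  assumes "diagonal_op n s S" "i < n" "j < n"
  shows "(\<Sum>q\<in>q_idx (quantum_M n). S [(0, i, j)] [q] * h q) = s i j * h (0, i, j)"
proof -
  have "(\<Sum>q\<in>q_idx (quantum_M n). S [(0, i, j)] [q] * h q)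
      = (\<Sum>k<n. \<Sum>l<n. if k = i \<and> l = j then s i j * h (0, k, l) else 0)"
    unfolding sum_q_idx_quantum_M using assms
    by (intro sum.cong refl) (simp add: diagonal_op_def)
  then show ?thesis using assms by (simp add: sum_delta_pair)
qed

lemma ops_0_2_eqI:
  assumes "S \<in> ops (quantum_M n) 0 2" "T \<in> ops (quantum_M n) 0 2"
    and "\<And>i j k l. i < n \<Longrightarrow> j < n \<Longrightarrow> k < n \<Longrightarrow> l < n \<Longrightarrow>
           S [(0, i, j), (0, k, l)] [] = T [(0, i, j), (0, k, l)] []"
  shows "S = T"
proof (intro ext)
  fix ys xs
  show "S ys xs = T ys xs"
  proof (cases "ys \<in> multi_idx (quantum_M n) 2 \<and> xs \<in> multi_idx (quantum_M n) 0")
    case True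
    then obtain p q where "ys = [p, q]" "p \<in> q_idx (quantum_M n)" "q \<in> q_idx (quantum_M n)" "xs = []"
      by (auto simp: numeral_2_eq_2 elim!: multi_idx_SucE)
    then show ?thesis
      using assms(3) by (auto simp: q_idx_quantum_M)
  next
    case False
    then show ?thesis using assms(1,2) by (simp add: ops_def)
  qed
qed

lemma mk_op_in_ops: "mk_op X k l f \<in> ops X k l"
  by (auto simp: ops_def mk_op_def)

lemma flip_vector_unique:
  "flip_vector n t S \<Longrightarrow> flip_vector n t T \<Longrightarrow> S = T"
  by (rule ops_0_2_eqI) (auto simp: flip_vector_def)

lemma flip_vector_cong:
  "flip_vector n t T \<Longrightarrow> (\<And>i j. i < n \<Longrightarrow> j < n \<Longrightarrow> t i j = t' i j) \<Longrightarrow> flip_vector n t' T"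
  by (simp add: flip_vector_def)

lemma ops_op_dagger: "T \<in> ops X k l \<Longrightarrow> op_dagger T \<in> ops X l k"
  by (auto simp: ops_def op_dagger_def)

lemma flip_vector_R_op: "flip_vector n (\<lambda>_ _. 1) (R_op (quantum_M n))"
  unfolding flip_vector_def
proof (intro conjI allI impI)
  show "R_op (quantum_M n) \<in> ops (quantum_M n) 0 2"
    unfolding R_op_def mult_op_def unit_op_def
    by (intro ops_op_comp ops_op_dagger mk_op_in_ops)
next
  fix i j k l assume l: "i < n" "j < n" "k < n" "l < n"
  then have n: "complex_of_real (sqrt n) \<noteq> 0" by simp
  have "R_op (quantum_M n) [(0, i, j), (0, k, l)] []
      = (\<Sum>a<n. \<Sum>b<n. cnj (mult_op (quantum_M n) [(0, a, b)] [(0, i, j), (0, k, l)]) *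
           unit_op (quantum_M n) [(0, a, b)] [])"
    by (simp add: R_op_def op_comp_def sum_multi_idx_1 sum_q_idx_quantum_M op_dagger_def)
  also have "\<dots> = (\<Sum>a<n. \<Sum>b<n. if a = i \<and> b = l then (if k = j \<and> l = i then 1 else 0) else 0)"
    using l n by (intro sum.cong refl) (auto simp: mult_op_quantum_M unit_op_quantum_M)
  also have "\<dots> = (if k = j \<and> l = i then 1 else 0)"
    using l by (simp add: sum_delta_pair)
  finally show "R_op (quantum_M n) [(0, i, j), (0, k, l)] [] = (if k = j \<and> l = i then 1 else 0)" .
qed

lemma env_mult_flip_vector:
  assumes "flip_vector n t S" "flip_vector n u T"
  shows "flip_vector n (\<lambda>i j. (\<Sum>k<n. t i k * u k j) / of_nat n) (env_mult (quantum_M n) S T)"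
  unfolding flip_vector_def
proof (intro conjI allI impI)
  show "env_mult (quantum_M n) S T \<in> ops (quantum_M n) 0 2"
    by (simp add: env_mult_def mk_op_in_ops)
next
  fix a b c e assume l: "a < n" "b < n" "c < n" "e < n"
  let ?X = "quantum_M n" and ?s = "complex_of_real (sqrt n)"
  let ?m1 = "\<lambda>p r. q_coord ?X (0, a, b) (q_mult (q_basis ?X p) (q_basis ?X r))"
  let ?m2 = "\<lambda>s q. q_coord ?X (0, c, e) (q_mult (q_basis ?X s) (q_basis ?X q))"
  have "env_mult ?X S T [(0, a, b), (0, c, e)] []
      = (\<Sum>p\<in>q_idx ?X. \<Sum>q\<in>q_idx ?X. \<Sum>r\<in>q_idx ?X. \<Sum>s\<in>q_idx ?X.
           S [p, q] [] * T [r, s] [] * ?m1 p r * ?m2 s q)"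
    using l by (simp add: env_mult_def mk_op_def multi_idx_def)
  also have "\<dots> = (\<Sum>p\<in>q_idx ?X. \<Sum>q\<in>q_idx ?X. S [p, q] [] * (\<Sum>r\<in>q_idx ?X. ?m1 p r *
                    (\<Sum>s\<in>q_idx ?X. T [r, s] [] * ?m2 s q)))"
    by (simp add: sum_distrib_left mult_ac)
  also have "\<dots> = (\<Sum>i<n. \<Sum>j<n. t i j * (\<Sum>k<n. \<Sum>l<n. ?m1 (0, i, j) (0, k, l) *
                    (u k l * ?m2 (0, l, k) (0, j, i))))"
    by (subst sum_q_idx_quantum_M, intro sum.cong refl,
        simp only: lessThan_iff sum_flip_vector[OF assms(1)],
        subst sum_q_idx_quantum_M, intro arg_cong2[of _ _ _ _ times] sum.cong refl,
        simp only: lessThan_iff sum_flip_vector[OF assms(2)])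
  also have "\<dots> = (\<Sum>i<n. \<Sum>j<n. t i j * (\<Sum>k<n. \<Sum>l<n. if k = j \<and> l = b then
                    (if i = a \<and> c = b \<and> e = a then u j b / (?s * ?s) else 0) else 0))"
    using l
    by (intro sum.cong refl arg_cong2[of _ _ _ _ times]) (auto simp: q_coord_mult_quantum_M)
  also have "\<dots> = (\<Sum>i<n. \<Sum>j<n. t i j * (if i = a \<and> c = b \<and> e = a then u j b / (?s * ?s) else 0))"
    using l by (intro sum.cong refl arg_cong2[of _ _ _ _ times]) (subst sum_delta_pair, simp_all)
  also have "\<dots> = (\<Sum>i<n. if i = a then (\<Sum>j<n. t a j * (if c = b \<and> e = a then u j b / (?s * ?s) else 0)) else 0)"
    by (intro sum.cong refl) simp
  also have "\<dots> = (if c = b \<and> e = a then (\<Sum>j<n. t a j * u j b) / of_nat n else 0)"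
    using l by (cases "c = b \<and> e = a") (auto simp: of_real_sqrt_nat sum_divide_distrib)
  finally show "env_mult ?X S T [(0, a, b), (0, c, e)] []
      = (if c = b \<and> e = a then (\<Sum>k<n. t a k * u k b) / of_nat n else 0)" .
qed

lemma env_star_flip_vector:
  assumes "flip_vector n t T"
  shows "flip_vector n (\<lambda>i j. cnj (t j i)) (env_star (quantum_M n) T)"
  unfolding flip_vector_def
proof (intro conjI allI impI)
  show "env_star (quantum_M n) T \<in> ops (quantum_M n) 0 2"
    by (simp add: env_star_def mk_op_in_ops)
next
  fix a b c e assume l: "a < n" "b < n" "c < n" "e < n"
  let ?X = "quantum_M n"
  let ?s1 = "\<lambda>p. q_coord ?X (0, a, b) (q_star (q_basis ?X p))"
  let ?s2 = "\<lambda>p. q_coord ?X (0, c, e) (q_star (q_basis ?X p))"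
  have cnj_T: "(\<Sum>q\<in>q_idx ?X. cnj (T [(0, i, j), q] []) * h q) = cnj (t i j) * h (0, j, i)"
    if "i < n" "j < n" for i j h
    using arg_cong[OF sum_flip_vector[OF assms that, of "\<lambda>q. cnj (h q)"], of cnj] by simp
  have "env_star ?X T [(0, a, b), (0, c, e)] []
      = (\<Sum>p\<in>q_idx ?X. \<Sum>q\<in>q_idx ?X. cnj (T [p, q] []) * (?s1 p * ?s2 q))"
    using l by (simp add: env_star_def mk_op_def multi_idx_def mult.assoc)
  also have "\<dots> = (\<Sum>i<n. \<Sum>j<n. cnj (t i j) * (?s1 (0, i, j) * ?s2 (0, j, i)))"
    by (subst sum_q_idx_quantum_M, intro sum.cong refl, simp only: lessThan_iff cnj_T)
  also have "\<dots> = (\<Sum>i<n. \<Sum>j<n. if i = b \<and> j = a then (if c = b \<and> e = a then cnj (t i j) else 0) else 0)"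
    using l by (intro sum.cong refl) (auto simp: q_coord_star_quantum_M)
  also have "\<dots> = (if c = b \<and> e = a then cnj (t b a) else 0)"
    using l by (subst sum_delta_pair) simp_all
  finally show "env_star ?X T [(0, a, b), (0, c, e)] [] = (if c = b \<and> e = a then cnj (t b a) else 0)" .
qed

lemma env_swap_flip_vector:
  assumes "flip_vector n t T"
  shows "flip_vector n (\<lambda>i j. t j i) (env_swap (quantum_M n) T)"
  using assms
  by (auto simp: flip_vector_def env_swap_def mk_op_in_ops) (auto simp: mk_op_def multi_idx_def)

lemma edge_projection_flip_vector:
  assumes "diagonal_op n s (lin_op (quantum_M n) A)"
  shows "flip_vector n s (edge_projection (quantum_M n) A)"
  unfolding flip_vector_def
proof (intro conjI allI impI)
  have "op_tensor 1 1 (lin_op (quantum_M n) A) (op_id (quantum_M n) 1) \<in> ops (quantum_M n) (1 + 1) (1 + 1)"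
    unfolding lin_op_def op_id_def by (intro ops_op_tensor mk_op_in_ops)
  moreover have "R_op (quantum_M n) \<in> ops (quantum_M n) 0 2"
    using flip_vector_R_op by (simp add: flip_vector_def)
  ultimately show "edge_projection (quantum_M n) A \<in> ops (quantum_M n) 0 2"
    unfolding edge_projection_def by (intro ops_op_comp) (simp_all only: one_add_one)
next
  fix i j k l assume l: "i < n" "j < n" "k < n" "l < n"
  let ?X = "quantum_M n"
  have "edge_projection ?X A [(0, i, j), (0, k, l)] []
      = (\<Sum>p\<in>q_idx ?X. \<Sum>q\<in>q_idx ?X. lin_op ?X A [(0, i, j)] [p] * op_id ?X 1 [(0, k, l)] [q] * R_op ?X [p, q] [])"
    by (simp add: edge_projection_def op_comp_def sum_multi_idx_2 op_tensor_def)
  also have "\<dots> = (\<Sum>p\<in>q_idx ?X. lin_op ?X A [(0, i, j)] [p] *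
                    (\<Sum>q\<in>q_idx ?X. R_op ?X [p, q] [] * op_id ?X 1 [(0, k, l)] [q]))"
    by (simp add: sum_distrib_left mult_ac)
  also have "\<dots> = s i j * (\<Sum>q\<in>q_idx ?X. R_op ?X [(0, i, j), q] [] * op_id ?X 1 [(0, k, l)] [q])"
    by (rule sum_diagonal_op[OF assms l(1,2)])
  also have "\<dots> = s i j * op_id ?X 1 [(0, k, l)] [(0, j, i)]"
    using l by (simp add: sum_flip_vector[OF flip_vector_R_op])
  also have "\<dots> = (if k = j \<and> l = i then s i j else 0)"
    using l by (simp add: op_id_def mk_op_def multi_idx_def)
  finally show "edge_projection ?X A [(0, i, j), (0, k, l)] [] = (if k = j \<and> l = i then s i j else 0)" .
qed

lemma diag_conj_index:
  assumes "a \<in> carrier_mat n n" "i < n" "j < n"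
  shows "(mat_diag n d * a * mat_diag n d) $$ (i, j) = d i * a $$ (i, j) * d j"
proof -
  have "mat_diag n d * a \<in> carrier_mat n n"
    by (rule mult_carrier_mat[OF mat_diag_dim assms(1)])
  then have "(mat_diag n d * a * mat_diag n d) $$ (i, j) = (mat_diag n d * a) $$ (i, j) * d j"
    using assms by (simp add: mat_diag_mult_right)
  then show ?thesis
    using assms by (simp add: mat_diag_mult_left)
qed

lemma diag_conj_carrier [simp]:
  "a \<in> carrier_mat n n \<Longrightarrow> mat_diag n d * a * mat_diag n d \<in> carrier_mat n n"
  by (intro mult_carrier_mat) auto

lemma diagonal_lin_op:
  "diagonal_op n (\<lambda>i j. d i * d j) (lin_op (quantum_M n) (map (\<lambda>x. mat_diag n d * x * mat_diag n d)))"
  unfolding diagonal_op_def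
  by (auto simp: lin_op_def mk_op_def multi_idx_def q_basis_quantum_M q_coord_quantum_M diag_conj_index
      simp del: index_mult_mat)

lemma q_linear_diag_conj:
  fixes d :: "nat \<Rightarrow> complex"
  shows "q_linear (quantum_M n) (map (\<lambda>x. mat_diag n d * x * mat_diag n d))"
  unfolding q_linear_def q_carrier_quantum_M
proof (intro conjI ballI allI; elim imageE; hypsubst)
  fix a b :: "complex mat" assume ab: "a \<in> carrier_mat n n" "b \<in> carrier_mat n n"
  have "mat_diag n d * (a + b) * mat_diag n d = mat_diag n d * a * mat_diag n d + mat_diag n d * b * mat_diag n d"
    by (rule eq_matI) (use ab in \<open>simp_all add: diag_conj_index carrier_matD[OF mat_diag_dim] algebra_simps del: index_mult_mat(1)\<close>)
  then show "map (\<lambda>x. mat_diag n d * x * mat_diag n d) (q_add [a] [b]) =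
             q_add (map (\<lambda>x. mat_diag n d * x * mat_diag n d) [a]) (map (\<lambda>x. mat_diag n d * x * mat_diag n d) [b])"
    by (simp add: q_add_def)
next
  fix a :: "complex mat" and c assume a: "a \<in> carrier_mat n n"
  have "mat_diag n d * (c \<cdot>\<^sub>m a) * mat_diag n d = c \<cdot>\<^sub>m (mat_diag n d * a * mat_diag n d)"
    by (rule eq_matI) (use a in \<open>simp_all add: diag_conj_index carrier_matD[OF mat_diag_dim] algebra_simps del: index_mult_mat(1)\<close>)
  then show "map (\<lambda>x. mat_diag n d * x * mat_diag n d) (q_smult c [a]) =
             q_smult c (map (\<lambda>x. mat_diag n d * x * mat_diag n d) [a])"
    by (simp add: q_smult_def)
qed auto

text \<open>
  The coefficient matrix of the edge projection is \<open>d d\<^sup>T\<close>, a real symmetric matrix with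
  \<open>(d d\<^sup>T) (d d\<^sup>T) = (\<Sum> d\<^sub>k\<^sup>2) d d\<^sup>T\<close>, and that of \<open>R\<close> is the all-ones matrix. So the normalisation of the
  squares gives idempotence, and the vanishing trace excludes loops.
\<close>

lemma simple_quantum_graph_diag_conj:
  fixes d :: "nat \<Rightarrow> complex"
  assumes n: "n > 0" and real: "\<And>i. i < n \<Longrightarrow> cnj (d i) = d i"
    and square: "(\<Sum>i<n. d i * d i) = of_nat n" and trace: "(\<Sum>i<n. d i) = 0"
  shows "simple_quantum_graph (quantum_M n) (map (\<lambda>x. mat_diag n d * x * mat_diag n d))"
proof -
  let ?A = "map (\<lambda>x. mat_diag n d * x * mat_diag n d)"
  let ?P = "edge_projection (quantum_M n) ?A"
  have P: "flip_vector n (\<lambda>i j. d i * d j) ?P"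
    by (rule edge_projection_flip_vector[OF diagonal_lin_op])
  have "flip_vector n (\<lambda>i j. d i * d j) (env_mult (quantum_M n) ?P ?P)"
  proof (rule flip_vector_cong[OF env_mult_flip_vector[OF P P]])
    fix i j
    have "(\<Sum>k<n. d i * d k * (d k * d j)) = d i * d j * (\<Sum>k<n. d k * d k)"
      by (simp add: sum_distrib_left mult_ac)
    then show "(\<Sum>k<n. d i * d k * (d k * d j)) / of_nat n = d i * d j"
      using n square by simp
  qed
  then have idem: "env_mult (quantum_M n) ?P ?P = ?P"
    using P by (rule flip_vector_unique)
  have "flip_vector n (\<lambda>i j. d i * d j) (env_star (quantum_M n) ?P)"
    by (rule flip_vector_cong[OF env_star_flip_vector[OF P]]) (simp add: real)
  then have star: "env_star (quantum_M n) ?P = ?P"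
    using P by (rule flip_vector_unique)
  have "flip_vector n (\<lambda>i j. d i * d j) (env_swap (quantum_M n) ?P)"
    by (rule flip_vector_cong[OF env_swap_flip_vector[OF P]]) simp
  then have swap: "env_swap (quantum_M n) ?P = ?P"
    using P by (rule flip_vector_unique)
  have "flip_vector n (\<lambda>_ _. 0) (env_mult (quantum_M n) ?P (R_op (quantum_M n)))"
    by (rule flip_vector_cong[OF env_mult_flip_vector[OF P flip_vector_R_op]])
       (simp add: trace flip: sum_distrib_left)
  then have loops: "env_mult (quantum_M n) ?P (R_op (quantum_M n)) = (\<lambda>ys xs. 0)"
    by (rule flip_vector_unique) (simp add: flip_vector_def ops_def)
  show ?thesis
    using n idem star swap loops q_linear_diag_conj
    by (simp add: simple_quantum_graph_def quantum_graph_def finite_quantum_set_def quantum_M_def)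
qed


section \<open>The obstruction to being classical\<close>

lemma diagonal_op_comp:
  assumes "diagonal_op n s S" "diagonal_op n t T"
  shows "diagonal_op n (\<lambda>i j. s i j * t i j) (op_comp (quantum_M n) 1 S T)"
  using assms(2) unfolding diagonal_op_def[of n t] diagonal_op_def[of n "\<lambda>i j. s i j * t i j"]
  by (simp add: op_comp_def sum_multi_idx_1 sum_diagonal_op[OF assms(1)])

lemma schur_product_diagonal_op:
  assumes S: "diagonal_op n s S" and T: "diagonal_op n t T" and l: "a < n" "b < n"
  shows "schur_product (quantum_M n) S T [(0, a, b)] [(0, a, b)] = (\<Sum>j<n. s a j * t j b) / of_nat n"
proof -
  let ?X = "quantum_M n" and ?m = "mult_op (quantum_M n) [(0, a, b)]"
  have "schur_product ?X S T [(0, a, b)] [(0, a, b)] =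
     (\<Sum>p\<in>q_idx ?X. \<Sum>q\<in>q_idx ?X. ?m [p, q] *
       (\<Sum>r\<in>q_idx ?X. S [p] [r] * (\<Sum>s\<in>q_idx ?X. T [q] [s] * cnj (?m [r, s]))))"
    by (simp add: schur_product_eq sum_distrib_left mult_ac)
  also have "\<dots> = (\<Sum>i<n. \<Sum>j<n. \<Sum>k<n. \<Sum>l<n. ?m [(0, i, j), (0, k, l)] *
       (s i j * (t k l * cnj (?m [(0, i, j), (0, k, l)]))))"
    by (subst sum_q_idx_quantum_M, intro sum.cong refl, subst sum_q_idx_quantum_M,
        intro sum.cong refl, simp only: lessThan_iff sum_diagonal_op[OF S] sum_diagonal_op[OF T])
  also have "\<dots> = (\<Sum>i<n. \<Sum>j<n. \<Sum>k<n. \<Sum>l<n.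
       if k = j \<and> l = b then (if i = a then s a j * t j b / of_nat n else 0) else 0)"
    using l by (intro sum.cong refl) (auto simp: mult_op_quantum_M simp flip: of_real_sqrt_nat)
  also have "\<dots> = (\<Sum>i<n. \<Sum>j<n. if i = a then s a j * t j b / of_nat n else 0)"
    using l by (intro sum.cong refl) (subst sum_delta_pair, simp_all)
  also have "\<dots> = (\<Sum>i<n. if i = a then (\<Sum>j<n. s a j * t j b / of_nat n) else 0)"
    by (intro sum.cong refl) simp
  also have "\<dots> = (\<Sum>j<n. s a j * t j b) / of_nat n"
    using l by (simp add: sum_divide_distrib)
  finally show ?thesis .
qed

lemma intertwiners_schur_product:
  assumes "S \<in> intertwiners X A 1 1" "T \<in> intertwiners X A 1 1"
  shows "schur_product X S T \<in> intertwiners X A 1 1"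
proof -
  have "op_tensor 1 1 S T \<in> intertwiners X A 2 2"
    using intertwiners_tensor[OF assms] by (simp only: one_add_one)
  then show ?thesis
    unfolding schur_product_def
    by (intro intertwiners_comp intertwiners_dagger intertwiners_mult_op)
qed

text \<open>
  The isomorphism is only known to respect the operations on intertwiners, so each intermediate
  operator of the Schur product has to be recognised as one.
\<close>

lemma iso_schur_product:
  assumes iso: "monoidal_dagger_iso X1 A1 X2 A2 \<Phi>" and m: "\<Phi> 2 1 (mult_op X1) = mult_op X2"
    and S: "S \<in> intertwiners X1 A1 1 1" and T: "T \<in> intertwiners X1 A1 1 1"
  shows "\<Phi> 1 1 (schur_product X1 S T) = schur_product X2 (\<Phi> 1 1 S) (\<Phi> 1 1 T)"
proof -
  have comp: "\<Phi> j l (op_comp X1 k S T) = op_comp X2 k (\<Phi> k l S) (\<Phi> j k T)"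
    if "S \<in> intertwiners X1 A1 k l" "T \<in> intertwiners X1 A1 j k" for j k l S T
    using iso that unfolding monoidal_dagger_iso_def by blast
  have mult: "mult_op X1 \<in> intertwiners X1 A1 2 1"
    by (rule intertwiners_mult_op)
  have "\<Phi> (1 + 1) (1 + 1) (op_tensor 1 1 S T) = op_tensor 1 1 (\<Phi> 1 1 S) (\<Phi> 1 1 T)"
    using iso S T unfolding monoidal_dagger_iso_def by blast
  then have tensor: "\<Phi> 2 2 (op_tensor 1 1 S T) = op_tensor 1 1 (\<Phi> 1 1 S) (\<Phi> 1 1 T)"
    by (simp only: one_add_one)
  have tensor_mem: "op_tensor 1 1 S T \<in> intertwiners X1 A1 2 2"
    using intertwiners_tensor[OF S T] by (simp only: one_add_one)
  have dagger: "\<Phi> 1 2 (op_dagger (mult_op X1)) = op_dagger (mult_op X2)"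
    using iso mult m unfolding monoidal_dagger_iso_def by metis
  show ?thesis
    unfolding schur_product_def
    by (simp only: comp tensor_mem mult intertwiners_comp[OF tensor_mem intertwiners_dagger[OF mult]]
        intertwiners_dagger[OF mult] tensor dagger m)
qed

text \<open>
  The obstruction: the Schur products formed in both orders have the same image under the
  isomorphism, which is injective on intertwiners.
\<close>

lemma classical_schur_commute:
  assumes iso: "quantum_isomorphic X A Y B" and Y: "classical_graph Y B"
    and S: "S \<in> intertwiners X A 1 1" and T: "T \<in> intertwiners X A 1 1"
  shows "schur_product X S T = schur_product X T S"
proof -
  obtain \<Phi> where \<Phi>: "monoidal_dagger_iso X A Y B \<Phi>" and m: "\<Phi> 2 1 (mult_op X) = mult_op Y"
    using iso by (auto simp: quantum_isomorphic_def)
  have "\<Phi> 1 1 (schur_product X S T) = schur_product Y (\<Phi> 1 1 S) (\<Phi> 1 1 T)"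
    by (rule iso_schur_product[OF \<Phi> m S T])
  also have "\<dots> = schur_product Y (\<Phi> 1 1 T) (\<Phi> 1 1 S)"
    using Y by (intro schur_product_commute) (simp add: classical_graph_def)
  also have "\<dots> = \<Phi> 1 1 (schur_product X T S)"
    by (rule iso_schur_product[OF \<Phi> m T S, symmetric])
  finally have "\<Phi> 1 1 (schur_product X S T) = \<Phi> 1 1 (schur_product X T S)" .
  moreover have "inj_on (\<Phi> 1 1) (intertwiners X A 1 1)"
    using \<Phi> by (auto simp: monoidal_dagger_iso_def bij_betw_def)
  ultimately show ?thesis
    using intertwiners_schur_product[OF S T] intertwiners_schur_product[OF T S]
    by (auto dest: inj_onD)
qed

text \<open>
  With \<open>D\<close> the diagonal matrix, the Schur products of \<open>A\<close> and \<open>A\<^sup>2\<close> in the two orders are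
  \<open>x \<mapsto> (Tr D\<^sup>3 / n) D x D\<^sup>2\<close> and \<open>x \<mapsto> (Tr D\<^sup>3 / n) D\<^sup>2 x D\<close>. If \<open>Tr D\<^sup>3 \<noteq> 0\<close>, they differ at the
  matrix unit \<open>E\<^sub>a\<^sub>b\<close> as soon as \<open>d\<^sub>a\<close> and \<open>d\<^sub>b\<close> are distinct and nonzero.
\<close>

lemma not_classical_diag_conj:
  fixes d :: "nat \<Rightarrow> complex"
  assumes cube: "(\<Sum>i<n. d i ^ 3) \<noteq> 0"
    and ab: "a < n" "b < n" "d a \<noteq> d b" "d a \<noteq> 0" "d b \<noteq> 0"
    and A: "A = map (\<lambda>x. mat_diag n d * x * mat_diag n d)"
    and Y: "classical_graph Y B"
  shows "\<not> quantum_isomorphic (quantum_M n) A Y B"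
proof
  let ?X = "quantum_M n" and ?S = "lin_op (quantum_M n) A"
  let ?S2 = "op_comp ?X 1 ?S ?S"
  assume iso: "quantum_isomorphic (quantum_M n) A Y B"
  have mem: "?S \<in> intertwiners ?X A 1 1" "?S2 \<in> intertwiners ?X A 1 1"
    by (intro intertwiners_comp intertwiners_lin_op)+
  have S: "diagonal_op n (\<lambda>i j. d i * d j) ?S"
    unfolding A by (rule diagonal_lin_op)
  have S2: "diagonal_op n (\<lambda>i j. (d i * d j) * (d i * d j)) ?S2"
    by (rule diagonal_op_comp[OF S S])
  have "schur_product ?X ?S ?S2 [(0, a, b)] [(0, a, b)] = (\<Sum>i<n. d i ^ 3) * (d a * d b ^ 2) / of_nat n"
    unfolding schur_product_diagonal_op[OF S S2 ab(1,2)]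
    by (simp add: sum_distrib_left
        power2_eq_square power3_eq_cube mult_ac)
  moreover have "schur_product ?X ?S2 ?S [(0, a, b)] [(0, a, b)] = (\<Sum>i<n. d i ^ 3) * (d a ^ 2 * d b) / of_nat n"
    unfolding schur_product_diagonal_op[OF S2 S ab(1,2)]
    by (simp add: sum_distrib_left
        power2_eq_square power3_eq_cube mult_ac)
  moreover have "schur_product ?X ?S ?S2 = schur_product ?X ?S2 ?S"
    by (rule classical_schur_commute[OF iso Y mem])
  ultimately have "d a * d b ^ 2 = d a ^ 2 * d b"
    using cube ab(1) by simp
  then show False
    using ab(3-5) by (simp add: power2_eq_square)
qed

lemma lambda8_diag:
  "lambda8 = mat_diag 3 (\<lambda>i. (if i = 2 then -2 else 1) / complex_of_real (sqrt 2))"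
  by (rule eq_matI)
     (auto simp: lambda8_def mat_diag_def mat_of_rows_list_def numeral_3_eq_3 numeral_2_eq_2 less_Suc_eq)

theorem mainTheorem5:
  fixes A :: "qelem \<Rightarrow> qelem"
  assumes A: "A = map (\<lambda>x. lambda8 * x * lambda8)"
  shows "simple_quantum_graph (quantum_M 3) A \<and>
         \<not> (\<exists>Y B. classical_graph Y B \<and> quantum_isomorphic (quantum_M 3) A Y B)"
proof -
  define d :: "nat \<Rightarrow> complex" where "d i = (if i = 2 then -2 else 1) / complex_of_real (sqrt 2)" for i
  have A': "A = map (\<lambda>x. mat_diag 3 d * x * mat_diag 3 d)"
    unfolding A lambda8_diag d_def ..
  have sq: "complex_of_real (sqrt 2) * complex_of_real (sqrt 2) = 2"
    by (simp flip: of_real_mult)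
  have "simple_quantum_graph (quantum_M 3) A"
    unfolding A'
    by (rule simple_quantum_graph_diag_conj) (simp_all add: d_def eval_nat_numeral sq)
  moreover have "\<not> quantum_isomorphic (quantum_M 3) A Y B" if "classical_graph Y B" for Y B
    by (rule not_classical_diag_conj[OF _ _ _ _ _ _ A' that, of 0 2])
       (simp_all add: d_def eval_nat_numeral field_simps)
  ultimately show ?thesis by blast
qed

end
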